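(* Let $p_{-1},p_{1},p_{-1,1}$ be weights and let $$B(x,y,t)=\sum_{w}\Big(\prod_{s\in w}p_s\Big)x^{\min(w)}y^{\max(w)}t^{|w|},$$ the sum running over all Dyck N-bridges $w$. Then $B(x,y,t)$ is algebraic of degree $4$. In the unweighted case $p_{-1}=p_{1}=p_{-1,1}=1$, the series $B(1,1,t)$ is algebraic of degree $2$ and $$B(1,1,t)=\frac{1-6t^2}{\sqrt{1-8t^2}\,(1-9t^2)}=1+7t^2+63t^4+583t^6+5407t^8+\cdots,$$ and the number $[t^n]B(1,1,t)$ of unweighted Dyck N-bridges of length $n$ satisfies, as $n\to\infty$, $$[t^n]B(1,1,t)=\frac{1+(-1)^n}{2}\left(3^n-\frac{2\sqrt2}{\sqrt\pi}\frac{8^{n/2}}{\sqrt n}+\mathcal O\!\left(\frac{8^{n/2}}{n^{3/2}}\right)\right).$$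
   Context: An N-step is a non-empty finite set of integers. Given a finite set $S$ of N-steps, an N-walk of length $n$ is a sequence $w=(s_1,\dots,s_n)$ of elements of $S$; it starts at $0$. A classical walk $v=(v_1,\dots,v_n)$ (integers, starting at $0$, with positions $\omega_k=\sum_{i\le k}v_i$) is compatible with $w$ if $v_i\in s_i$ for all $i$. A classical bridge is a walk with $\omega_n=0$; a classical meander has $\omega_k\ge 0$ for all $k$; a classical excursion is a meander with $\omega_n=0$. An N-walk is an N-bridge (resp. N-meander, N-excursion) if it is compatible with at least one bridge (resp. meander, excursion). The reachable points of an N-walk are the endpoints $\omega_n$ of all compatible walks; $\min(w)$ and $\max(w)$ denote the minimum and maximum reachable point. Dyck N-walks are N-walks on the N-step set $S_D=\{\{-1\},\{1\},\{-1,1\}\}$; each N-step $s$ carries a weight $p_s$ (written $p_{-1},p_1,p_{-1,1}$), and the weight of an N-walk is the product of the weights of its N-steps. *)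

theory Defs
  imports
    Complex_Main
    "HOL-Computational_Algebra.Computational_Algebra"
    "HOL-Library.Landau_Symbols"
begin

subsection \<open>Walks and N-walks\<close>

type_synonym nstep = "int set"

definition walk_pos :: "int list \<Rightarrow> nat \<Rightarrow> int" where
  "walk_pos v k = sum_list (take k v)"

definition bridge :: "int list \<Rightarrow> bool" where
  "bridge v \<longleftrightarrow> walk_pos v (length v) = 0"

definition compatible :: "int list \<Rightarrow> nstep list \<Rightarrow> bool" where
  "compatible v w \<longleftrightarrow> list_all2 (\<lambda>i s. i \<in> s) v w"

definition nbridge :: "nstep list \<Rightarrow> bool" where
  "nbridge w \<longleftrightarrow> (\<exists>v. compatible v w \<and> bridge v)"

definition reachable :: "nstep list \<Rightarrow> int set" where
  "reachable w = {walk_pos v (length v) | v. compatible v w}"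

definition min_reach :: "nstep list \<Rightarrow> int" where
  "min_reach w = Min (reachable w)"

definition max_reach :: "nstep list \<Rightarrow> int" where
  "max_reach w = Max (reachable w)"

definition dyck_nsteps :: "nstep set" where
  "dyck_nsteps = {{-1}, {1}, {-1, 1}}"

definition nbridges :: "nstep set \<Rightarrow> nat \<Rightarrow> nstep list set" where
  "nbridges S n = {w. length w = n \<and> set w \<subseteq> S \<and> nbridge w}"

text \<open>
  The series \<open>B(x,y,t)\<close>, as a power series in \<open>t\<close>. The weights and the values
  of \<open>x\<close> and \<open>y\<close> are taken from a field \<open>'k\<close>, so that the same definition covers
  both indeterminate \<open>x\<close>, \<open>y\<close> and the specialisation \<open>x = y = 1\<close>; negative powers
  of \<open>x\<close> do occur.
\<close>
definition dyck_nbridge_gf :: "(nstep \<Rightarrow> 'k::field) \<Rightarrow> 'k \<Rightarrow> 'k \<Rightarrow> 'k fps" where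
  "dyck_nbridge_gf p x y =
     Abs_fps (\<lambda>n. \<Sum>w\<in>nbridges dyck_nsteps n.
       prod_list (map p w) * x powi min_reach w * y powi max_reach w)"

subsection \<open>Rational functions in two indeterminates\<close>

text \<open>The field \<open>'a(x,y)\<close>, as the fraction field of \<open>'a[x][y]\<close>.\<close>
type_synonym 'a ratfun2 = "'a poly poly fract"

definition rf_const :: "'a::field \<Rightarrow> 'a ratfun2" where
  "rf_const c = to_fract [:[:c:]:]"

definition rf_x :: "'a::field ratfun2" where
  "rf_x = to_fract [:[:0, 1:]:]"

definition rf_y :: "'a::field ratfun2" where
  "rf_y = to_fract [:0, 1:]"

subsection \<open>Algebraic power series\<close>

text \<open>
  \<open>P\<close> is a polynomial in one unknown with coefficients in \<open>'k[t]\<close>, where \<open>t\<close> is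
  the variable of the power series.
\<close>
definition annihilates :: "'k::field poly poly \<Rightarrow> 'k fps \<Rightarrow> bool" where
  "annihilates P f \<longleftrightarrow> P \<noteq> 0 \<and> poly (map_poly fps_of_poly P) f = 0"

text \<open>
  The degree is that of \<open>f\<close> over \<open>'k(t)\<close>; clearing denominators, coefficients in
  \<open>'k[t]\<close> suffice. For \<open>'k = 'a ratfun2\<close> this is the degree over \<open>'a(x,y,t)\<close>.
\<close>
definition algebraic_of_degree :: "'k::field fps \<Rightarrow> nat \<Rightarrow> bool" where
  "algebraic_of_degree f d \<longleftrightarrow>
     (\<exists>P. annihilates P f \<and> degree P = d) \<and> (\<forall>P. annihilates P f \<longrightarrow> d \<le> degree P)"

end

theory Submission
  imports Defs "HOL-Analysis.Analysis"
begin

text \<open>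
  The reachable points of a Dyck N-walk are all integers of the right parity between its minimum and
  its maximum, so an N-walk of even length is a bridge unless its minimum is positive or its maximum
  is negative. These two cases are disjoint, and each is counted by a classical walk with steps
  \<open>\<plusminus>1\<close>, where counting the positive endpoints reduces to central binomial coefficients. Let
  \<open>d\<close>, \<open>u\<close>, \<open>e\<close> be the weights of the three N-steps, with the powers of \<open>x\<close> and \<open>y\<close> absorbed, and
  \<open>\<sigma> = d + u + e\<close>. Then
  \<open>2 B (1 - \<sigma>\<^sup>2 t\<^sup>2) = (1 - 2\<sigma>u t\<^sup>2) / sqrt d1 + (1 - 2\<sigma>d t\<^sup>2) / sqrt d2\<close>, where
  \<open>d1 = 1 - 4u(d + e) t\<^sup>2\<close> and \<open>d2 = 1 - 4d(u + e) t\<^sup>2\<close>. The degree is \<open>4\<close> because none of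
  \<open>d1\<close>, \<open>d2\<close>, \<open>d1 d2\<close> is a square of a polynomial; at \<open>x = y = 1\<close> without weights \<open>d1 = d2\<close>, and
  the degree drops to \<open>2\<close>.

  For the asymptotics let \<open>c\<^sub>m\<close> be the coefficients of \<open>1 / sqrt (1 - 8z)\<close> and \<open>b\<^sub>m\<close> the number of
  bridges of length \<open>2m\<close>. The error \<open>\<epsilon>\<^sub>m = b\<^sub>m - 9\<^sup>m + 2c\<^sub>m\<close> satisfies
  \<open>\<epsilon>\<^sub>m\<^sub>+\<^sub>1 = 9\<epsilon>\<^sub>m - 12c\<^sub>m / (m + 1)\<close>, and \<open>\<epsilon>\<^sub>m / 9\<^sup>m\<close> tends to \<open>0\<close> because
  \<open>\<Sum> c\<^sub>m / 9\<^sup>m = 3\<close>; this forces \<open>0 \<le> \<epsilon>\<^sub>m \<le> 12c\<^sub>m / (m + 1)\<close>. Wallis' product gives the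
  size of \<open>c\<^sub>m\<close>.
\<close>

subsection \<open>Series generated by square roots\<close>

text \<open>The degree criteria need characteristic 0; this instance makes them applicable over the
  field of rational functions in \<open>x\<close> and \<open>y\<close>.\<close>

instance fract :: ("{idom,ring_char_0}") field_char_0
proof
  show "inj (of_nat :: nat \<Rightarrow> 'a fract)"
    by (intro injI) (simp add: of_nat_fract eq_fract)
qed

text \<open>The descent known from irrationality proofs of square roots: with \<open>q\<close> the
  polynomial part of \<open>a / b\<close>, the fraction \<open>(d * b - q * a) / (a - q * b)\<close>
  again has square \<open>d\<close>, and its denominator has smaller degree.\<close>

lemma poly_quotient_square:
  fixes a b d :: "'k::field poly"
  assumes "a\<^sup>2 = d * b\<^sup>2" and "b \<noteq> 0"
  shows "\<exists>c. d = c\<^sup>2"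
  using assms
proof (induction "degree b" arbitrary: a b rule: less_induct)
  case less
  define q r where "q = a div b" and "r = a mod b"
  have a: "a = q * b + r" by (simp add: q_def r_def)
  show ?case
  proof (cases "r = 0")
    case True
    then have "(q\<^sup>2 - d) * b\<^sup>2 = 0"
      using less.prems a by (simp add: algebra_simps power_mult_distrib)
    then show ?thesis using less.prems by auto
  next
    case False
    then have "degree r < degree b"
      using degree_mod_less[OF less.prems(2)] by (auto simp: r_def)
    \<comment> \<open>The norm form \<open>X^2 - d * Y^2\<close> is multiplicative; here it is
      applied to \<open>(a + b sqrt d) (sqrt d - q)\<close>.\<close>
    moreover have "(d * b - q * a)\<^sup>2 - d * r\<^sup>2 = (a\<^sup>2 - d * b\<^sup>2) * (q\<^sup>2 - d)"
    proof -
      have r: "r = a - q * b" using a by simp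
      show ?thesis unfolding r by (simp add: power2_eq_square algebra_simps)
    qed
    then have "(d * b - q * a)\<^sup>2 = d * r\<^sup>2" using less.prems(1) by simp
    ultimately show ?thesis
      using less.hyps[of r "d * b - q * a"] False by simp
  qed
qed

text \<open>A square root would be linear, \<open>u + v t\<close>, with \<open>2 u v = 0\<close>
  although \<open>u^2 = 1\<close> and \<open>v^2 = - m\<close> are nonzero.\<close>

lemma not_square_quadratic:
  fixes m :: "'k::field_char_0"
  assumes "m \<noteq> 0"
  shows "[:1, 0, -m:] \<noteq> c\<^sup>2"
proof
  assume c: "[:1, 0, -m:] = c\<^sup>2"
  then have "degree (c\<^sup>2) = 2" using assms by (simp flip: c)
  then have "degree c = 1" by (cases "c = 0") (auto simp: degree_power_eq)
  then obtain u v where "c = [:u, v:]" by (metis degree1_coeffs)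
  then show False using c assms by (auto simp: power2_eq_square)
qed

text \<open>In a square root \<open>u + v t + w t^2\<close> the linear coefficient vanishes since
  \<open>u^2 = 1\<close>. The remaining equations give \<open>(m1 + m2)^2 = 4 m1 m2\<close>, hence
  \<open>m1 = m2\<close>.\<close>

lemma not_square_quadratic_product:
  fixes m1 m2 :: "'k::field_char_0"
  assumes "m1 \<noteq> 0" "m2 \<noteq> 0" "m1 \<noteq> m2"
  shows "[:1, 0, -m1:] * [:1, 0, -m2:] \<noteq> c\<^sup>2"
proof
  assume c: "[:1, 0, -m1:] * [:1, 0, -m2:] = c\<^sup>2"
  have "degree ([:1, 0, -m1:] * [:1, 0, -m2:]) = 4"
    using assms by (subst degree_mult_eq) auto
  then have "degree (c\<^sup>2) = 4" by (simp only: c)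
  then have "degree c = 2" by (cases "c = 0") (auto simp: degree_power_eq)
  then obtain u v w where "c = [:u, v, w:]" by (metis degree2_coeffs)
  then have u: "u * u = 1" and "u * v = 0" and uw: "2 * (u * w) + v * v = - (m1 + m2)"
    and w: "w * w = m1 * m2"
    using c by (simp_all add: power2_eq_square algebra_simps)
  then have "v = 0" by auto
  then have "(m1 + m2)\<^sup>2 = 4 * ((u * u) * (w * w))"
    using arg_cong[OF uw, of "\<lambda>z. z\<^sup>2"] by (simp add: power2_eq_square algebra_simps)
  then have "(m1 - m2)\<^sup>2 = 0" unfolding u w by (simp add: power2_eq_square algebra_simps)
  then show False using assms by simp
qed

text \<open>A relation between \<open>1\<close> and \<open>D\<close> over \<open>k[t]\<close>
  squares to \<open>u^2 = d * v^2\<close>, which would make \<open>d\<close> a square unless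
  \<open>v = 0\<close>.\<close>

lemma sqrt_fps_independent:
  fixes D :: "'k::field fps"
  assumes D: "D\<^sup>2 = fps_of_poly d" and d: "\<And>c. d \<noteq> c\<^sup>2"
    and eq: "fps_of_poly u + fps_of_poly v * D = 0"
  shows "u = 0 \<and> v = 0"
proof -
  have "fps_of_poly (u\<^sup>2) = (fps_of_poly v * D)\<^sup>2"
    using eq by (metis add_eq_0_iff2 power2_minus fps_of_poly_power)
  also have "\<dots> = fps_of_poly (d * v\<^sup>2)"
    by (simp add: power_mult_distrib D fps_of_poly_mult fps_of_poly_power mult.commute)
  finally have "u\<^sup>2 = d * v\<^sup>2" by (simp only: fps_of_poly_eq_iff)
  with d have "v = 0" using poly_quotient_square by blast
  then show ?thesis using eq by (simp add: fps_of_poly_eq_iff[of u 0, simplified])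
qed

text \<open>Solving the relation for \<open>D2\<close> expresses it through \<open>D1\<close>. After
  squaring, the independence of \<open>1\<close> and \<open>D1\<close> leaves only cases in which
  one of \<open>d1\<close>, \<open>d2\<close>, \<open>d1 * d2\<close> would be a square, or all
  coefficients vanish.\<close>

lemma biquadratic_fps_independent:
  fixes D1 D2 :: "'k::field_char_0 fps"
  assumes D1: "D1\<^sup>2 = fps_of_poly d1" and D2: "D2\<^sup>2 = fps_of_poly d2"
    and d1: "\<And>c. d1 \<noteq> c\<^sup>2" and d2: "\<And>c. d2 \<noteq> c\<^sup>2" and d12: "\<And>c. d1 * d2 \<noteq> c\<^sup>2"
    and eq: "fps_of_poly c0 + fps_of_poly c1 * D1 + fps_of_poly c2 * D2
               + fps_of_poly c3 * D1 * D2 = 0"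
  shows "c0 = 0 \<and> c1 = 0 \<and> c2 = 0 \<and> c3 = 0"
proof -
  let ?F = "fps_of_poly :: 'k poly \<Rightarrow> 'k fps"
  note F = fps_of_poly_mult fps_of_poly_add fps_of_poly_diff fps_of_poly_power
  \<comment> \<open>Rationalising the denominator: \<open>X + Y * D1\<close> is
    \<open>c0 + c1 * D1\<close> times the conjugate of \<open>c2 + c3 * D1\<close>, and
    \<open>n\<close> is the norm of the latter.\<close>
  define X Y n where "X = c0 * c2 - c1 * c3 * d1" and "Y = c1 * c2 - c0 * c3"
    and "n = c2\<^sup>2 - c3\<^sup>2 * d1"
  have e: "?F c0 + ?F c1 * D1 = - (D2 * (?F c2 + ?F c3 * D1))"
    using eq by (simp add: eq_neg_iff_add_eq_0 algebra_simps)
  have "?F X + ?F Y * D1 = (?F c0 + ?F c1 * D1) * (?F c2 - ?F c3 * D1)"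
    by (simp add: X_def Y_def F flip: D1) (simp add: algebra_simps power2_eq_square)
  also have "\<dots> = - D2 * ?F n"
    unfolding e by (simp add: n_def F flip: D1) (simp add: algebra_simps power2_eq_square)
  finally have XY: "?F X + ?F Y * D1 = - D2 * ?F n" .
  have "?F (X\<^sup>2 + Y\<^sup>2 * d1 - d2 * n\<^sup>2) + ?F (2 * X * Y) * D1
          = (?F X + ?F Y * D1)\<^sup>2 - (D2 * ?F n)\<^sup>2"
    by (simp add: F flip: D1 D2) (simp add: algebra_simps power2_eq_square)
  also have "\<dots> = 0" unfolding XY by simp
  finally have "X\<^sup>2 + Y\<^sup>2 * d1 = d2 * n\<^sup>2 \<and> X * Y = 0"
    using sqrt_fps_independent[OF D1 d1] by fastforce
  then have sq: "X\<^sup>2 + Y\<^sup>2 * d1 = d2 * n\<^sup>2" and "X = 0 \<or> Y = 0" by auto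
  have "n = 0"
  proof (rule ccontr)
    assume n: "n \<noteq> 0"
    from \<open>X = 0 \<or> Y = 0\<close> show False
    proof
      assume "X = 0"
      then have "(Y * d1)\<^sup>2 = (d1 * d2) * n\<^sup>2"
        using sq by (simp add: power2_eq_square algebra_simps)
      then show False using poly_quotient_square[OF _ n] d12 by blast
    next
      assume "Y = 0"
      then have "X\<^sup>2 = d2 * n\<^sup>2" using sq by simp
      then show False using poly_quotient_square[OF _ n] d2 by blast
    qed
  qed
  then have "c2\<^sup>2 = d1 * c3\<^sup>2" by (simp add: n_def mult.commute)
  then have "c3 = 0" using poly_quotient_square d1 by blast
  with \<open>c2\<^sup>2 = d1 * c3\<^sup>2\<close> have "c2 = 0" by simp
  have "?F c0 + ?F c1 * D1 = 0" using eq \<open>c2 = 0\<close> \<open>c3 = 0\<close> by simp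
  then show ?thesis using sqrt_fps_independent[OF D1 d1] \<open>c2 = 0\<close> \<open>c3 = 0\<close> by blast
qed

section \<open>Degree criteria for series built from one or two square roots\<close>

lemma algebraic_of_degree_2I:
  fixes f D :: "'k::field_char_0 fps"
  assumes D: "D\<^sup>2 = fps_of_poly d" and d: "\<And>c. d \<noteq> c\<^sup>2" and "N \<noteq> 0" "a \<noteq> 0"
    and f: "fps_of_poly N * f = fps_of_poly a * D"
  shows "algebraic_of_degree f 2"
  unfolding algebraic_of_degree_def
proof (intro conjI exI allI impI)
  note F = fps_of_poly_mult fps_of_poly_add fps_of_poly_diff fps_of_poly_power
  let ?P = "[:- (a\<^sup>2 * d), 0, N\<^sup>2:]"
  show "degree ?P = 2" using assms by simp
  have "poly (map_poly fps_of_poly ?P) f = (fps_of_poly N * f)\<^sup>2 - (fps_of_poly a * D)\<^sup>2"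
    by (simp add: map_poly_pCons F fps_of_poly_uminus power_mult_distrib D)
      (simp add: power2_eq_square algebra_simps)
  then show "annihilates ?P f" using f assms by (simp add: annihilates_def)
next
  note F = fps_of_poly_mult fps_of_poly_add fps_of_poly_diff fps_of_poly_power
  fix P assume P: "annihilates P f"
  show "2 \<le> degree P"
  proof (rule ccontr)
    assume "\<not> 2 \<le> degree P"
    then have "P = [:coeff P 0, coeff P 1:]"
      by (intro poly_eqI) (auto simp: coeff_pCons coeff_eq_0 split: nat.splits)
    then obtain c0 c1 where c: "P = [:c0, c1:]" by metis
    then have "fps_of_poly c0 + f * fps_of_poly c1 = 0"
      using P by (simp add: annihilates_def map_poly_pCons)
    \<comment> \<open>Multiplied by \<open>N\<close>, a relation of degree at most 1 for
      \<open>f\<close> becomes a relation between \<open>1\<close> and \<open>D\<close>.\<close>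
    then have "fps_of_poly N * (fps_of_poly c0 + f * fps_of_poly c1) = 0" by simp
    then have "fps_of_poly (N * c0) + fps_of_poly c1 * (fps_of_poly N * f) = 0"
      by (simp add: F algebra_simps)
    then have "fps_of_poly (N * c0) + fps_of_poly (a * c1) * D = 0"
      unfolding f by (simp add: F algebra_simps)
    then have "N * c0 = 0 \<and> a * c1 = 0" by (rule sqrt_fps_independent[OF D d])
    then show False using assms c P by (simp add: annihilates_def)
  qed
qed

lemma algebraic_of_degree_4I:
  fixes f D1 D2 :: "'k::field_char_0 fps"
  assumes D1: "D1\<^sup>2 = fps_of_poly d1" and D2: "D2\<^sup>2 = fps_of_poly d2"
    and d1: "\<And>c. d1 \<noteq> c\<^sup>2" and d2: "\<And>c. d2 \<noteq> c\<^sup>2" and d12: "\<And>c. d1 * d2 \<noteq> c\<^sup>2"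
    and "N \<noteq> 0" "a \<noteq> 0" "b \<noteq> 0"
    and f: "fps_of_poly N * f = fps_of_poly a * D1 + fps_of_poly b * D2"
  shows "algebraic_of_degree f 4"
  unfolding algebraic_of_degree_def
proof (intro conjI exI allI impI)
  let ?F = "fps_of_poly :: 'k poly \<Rightarrow> 'k fps"
  note F = fps_of_poly_mult fps_of_poly_add fps_of_poly_diff fps_of_poly_power
  define A C where "A = a\<^sup>2 * d1" and "C = b\<^sup>2 * d2"
  \<comment> \<open>The minimal polynomial up to a factor: the product of
    \<open>N Z \<plusminus> a D1 \<plusminus> b D2\<close> over the four choices of signs.\<close>
  let ?P = "[:(A - C)\<^sup>2, 0, - 2 * (A + C) * N\<^sup>2, 0, N ^ 4:]"
  show "degree ?P = 4" using assms by simp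
  define u v where "u = ?F a * D1" and "v = ?F b * D2"
  have "?F A = u\<^sup>2" "?F C = v\<^sup>2"
    by (simp_all add: A_def C_def u_def v_def F power_mult_distrib D1 D2)
  then have "poly (map_poly fps_of_poly ?P) f
               = (u\<^sup>2 - v\<^sup>2)\<^sup>2 - 2 * (u\<^sup>2 + v\<^sup>2) * (?F N * f)\<^sup>2 + (?F N * f) ^ 4"
    by (simp add: map_poly_pCons F fps_of_poly_uminus power2_eq_square
        power4_eq_xxxx algebra_simps)
  also have "\<dots> = 0" unfolding f u_def[symmetric] v_def[symmetric]
    by (simp add: power2_eq_square power4_eq_xxxx algebra_simps)
  finally show "annihilates ?P f" using assms by (simp add: annihilates_def)
next
  let ?F = "fps_of_poly :: 'k poly \<Rightarrow> 'k fps"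
  note F = fps_of_poly_mult fps_of_poly_add fps_of_poly_diff fps_of_poly_power
  fix P assume P: "annihilates P f"
  show "4 \<le> degree P"
  proof (rule ccontr)
    assume "\<not> 4 \<le> degree P"
    then have "P = [:coeff P 0, coeff P 1, coeff P 2, coeff P 3:]"
      by (intro poly_eqI)
        (auto simp: coeff_pCons coeff_eq_0 numeral_2_eq_2 numeral_3_eq_3 split: nat.splits)
    then obtain c0 c1 c2 c3 where c: "P = [:c0, c1, c2, c3:]" by metis
    \<comment> \<open>Even powers of \<open>s\<close> are combinations of \<open>1\<close> and
      \<open>D1 * D2\<close>, odd powers of \<open>D1\<close> and \<open>D2\<close>. Hence
      \<open>c0\<close>, \<open>c2\<close> can be treated apart from \<open>c1\<close>,
      \<open>c3\<close>.\<close>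
    define s where "s = ?F a * D1 + ?F b * D2"
    have "?F c0 + f * (?F c1 + f * (?F c2 + f * ?F c3)) = 0"
      using P c by (simp add: annihilates_def map_poly_pCons)
    then have "(?F N) ^ 3 * (?F c0 + f * (?F c1 + f * (?F c2 + f * ?F c3))) = 0" by simp
    then have "?F (N ^ 3 * c0) + ?F (N\<^sup>2 * c1) * s + ?F (N * c2) * s\<^sup>2 + ?F c3 * s ^ 3 = 0"
      unfolding s_def f[symmetric]
      by (simp add: F power2_eq_square power3_eq_cube algebra_simps)
    moreover define e0 e1 e2 where "e0 = N ^ 3 * c0" and "e1 = N\<^sup>2 * c1" and "e2 = N * c2"
    ultimately have "?F e0 + ?F e1 * s + ?F e2 * s\<^sup>2 + ?F c3 * s ^ 3 = 0" by simp
    moreover have "s\<^sup>2 = ?F (a\<^sup>2 * d1 + b\<^sup>2 * d2) + ?F (2 * a * b) * D1 * D2"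
      by (simp add: F s_def flip: D1 D2) (simp add: power2_eq_square algebra_simps)
    moreover have "s ^ 3 = ?F (a ^ 3 * d1 + 3 * a * b\<^sup>2 * d2) * D1
                             + ?F (3 * a\<^sup>2 * b * d1 + b ^ 3 * d2) * D2"
      by (simp add: F s_def flip: D1 D2) (simp add: power2_eq_square power3_eq_cube algebra_simps)
    ultimately have
      "?F (e0 + e2 * (a\<^sup>2 * d1 + b\<^sup>2 * d2))
         + ?F (e1 * a + c3 * (a ^ 3 * d1 + 3 * a * b\<^sup>2 * d2)) * D1
         + ?F (e1 * b + c3 * (3 * a\<^sup>2 * b * d1 + b ^ 3 * d2)) * D2
         + ?F (2 * e2 * a * b) * D1 * D2 = 0"
      by (simp add: F s_def algebra_simps)
    from biquadratic_fps_independent[OF D1 D2 d1 d2 d12 this]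
    have e: "e0 + e2 * (a\<^sup>2 * d1 + b\<^sup>2 * d2) = 0" "2 * e2 * a * b = 0"
      and e1: "e1 * a + c3 * (a ^ 3 * d1 + 3 * a * b\<^sup>2 * d2) = 0"
      and e2: "e1 * b + c3 * (3 * a\<^sup>2 * b * d1 + b ^ 3 * d2) = 0"
      by auto
    from e have "e2 = 0" "e0 = 0" using assms by auto
    \<comment> \<open>Eliminating \<open>e1\<close> from the coefficients of \<open>D1\<close> and
      \<open>D2\<close> leaves \<open>c3\<close> times a difference that is nonzero because
      \<open>d1 * d2\<close> is not a square.\<close>
    have "2 * (a * b * (c3 * (a\<^sup>2 * d1 - b\<^sup>2 * d2)))
            = a * (e1 * b + c3 * (3 * a\<^sup>2 * b * d1 + b ^ 3 * d2))
            - b * (e1 * a + c3 * (a ^ 3 * d1 + 3 * a * b\<^sup>2 * d2))"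
      by (simp add: power2_eq_square power3_eq_cube algebra_simps)
    then have "c3 * (a\<^sup>2 * d1 - b\<^sup>2 * d2) = 0" unfolding e1 e2 using assms by simp
    moreover have "a\<^sup>2 * d1 \<noteq> b\<^sup>2 * d2"
    proof
      assume "a\<^sup>2 * d1 = b\<^sup>2 * d2"
      then have "(a * d1)\<^sup>2 = (d1 * d2) * b\<^sup>2" by (simp add: power2_eq_square algebra_simps)
      then show False using poly_quotient_square \<open>b \<noteq> 0\<close> d12 by blast
    qed
    ultimately have "c3 = 0" by simp
    with e1 have "e1 = 0" using assms by simp
    then show False
      using assms c P \<open>c3 = 0\<close> \<open>e0 = 0\<close> \<open>e2 = 0\<close>
      by (simp add: annihilates_def e0_def e1_def e2_def)
  qed
qed

subsection \<open>Walks with positive endpoint\<close>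

text \<open>The weighted sum of \<open>g\<close> over the endpoints of all classical
  \<open>\<plusminus>1\<close> walks with \<open>n\<close> steps; an up step has weight
  \<open>\<beta>\<close>, a down step \<open>\<alpha>\<close>. Splitting off a step shifts
  \<open>g\<close>, so no sum over lists is needed.\<close>

fun walk_sum :: "'k::comm_ring_1 \<Rightarrow> 'k \<Rightarrow> nat \<Rightarrow> (int \<Rightarrow> 'k) \<Rightarrow> 'k" where
  "walk_sum \<alpha> \<beta> 0 g = g 0"
| "walk_sum \<alpha> \<beta> (Suc n) g
     = \<beta> * walk_sum \<alpha> \<beta> n (\<lambda>z. g (z + 1)) + \<alpha> * walk_sum \<alpha> \<beta> n (\<lambda>z. g (z - 1))"

lemma walk_sum_add:
  "walk_sum \<alpha> \<beta> n (\<lambda>z. f z + g z) = walk_sum \<alpha> \<beta> n f + walk_sum \<alpha> \<beta> n g"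
  by (induction n arbitrary: f g) (simp_all add: algebra_simps)

lemma walk_sum_diff:
  "walk_sum \<alpha> \<beta> n (\<lambda>z. f z - g z) = walk_sum \<alpha> \<beta> n f - walk_sum \<alpha> \<beta> n g"
proof (induction n arbitrary: f g)
  case (Suc n)
  show ?case unfolding walk_sum.simps Suc.IH by (simp add: algebra_simps)
qed simp

lemma walk_sum_1: "walk_sum \<alpha> \<beta> n (\<lambda>_. 1) = (\<alpha> + \<beta>) ^ n"
  by (induction n) (simp_all add: algebra_simps)

abbreviation endpoint_sum :: "'k::comm_ring_1 \<Rightarrow> 'k \<Rightarrow> nat \<Rightarrow> int \<Rightarrow> 'k" where
  "endpoint_sum \<alpha> \<beta> n z \<equiv> walk_sum \<alpha> \<beta> n (\<lambda>i. of_bool (i = z))"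

lemma endpoint_sum_Suc:
  "endpoint_sum \<alpha> \<beta> (Suc n) z
     = \<beta> * endpoint_sum \<alpha> \<beta> n (z - 1) + \<alpha> * endpoint_sum \<alpha> \<beta> n (z + 1)"
proof -
  have "(\<lambda>i. of_bool (i + 1 = z)) = (\<lambda>i. of_bool (i = z - 1) :: 'a)"
    "(\<lambda>i. of_bool (i - 1 = z)) = (\<lambda>i. of_bool (i = z + 1) :: 'a)"
    by (auto simp: fun_eq_iff)
  then show ?thesis by simp
qed

lemma endpoint_sum_below: "z < - int n \<Longrightarrow> endpoint_sum \<alpha> \<beta> n z = 0"
  by (induction n arbitrary: z) (simp, simp only: endpoint_sum_Suc, simp)

lemma endpoint_sum_odd: "odd (z + int n) \<Longrightarrow> endpoint_sum \<alpha> \<beta> n z = 0"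
proof (induction n arbitrary: z)
  case (Suc n)
  then have "odd (z - 1 + int n)" "odd (z + 1 + int n)" by auto
  then show ?case unfolding endpoint_sum_Suc by (simp add: Suc.IH)
qed auto

text \<open>The endpoint \<open>2k - n\<close> means \<open>k\<close> steps up and
  \<open>n - k\<close> down; the induction is Pascal's rule. For \<open>k > n\<close> both sides
  vanish, whatever the truncated exponent is.\<close>

lemma endpoint_sum_eq_binomial:
  "endpoint_sum \<alpha> \<beta> n (2 * int k - int n) = of_nat (n choose k) * \<beta> ^ k * \<alpha> ^ (n - k)"
proof (induction n arbitrary: k)
  case 0
  then show ?case by (cases k) auto
next
  case (Suc n)
  have down: "2 * int k - int (Suc n) + 1 = 2 * int k - int n" by simp
  show ?case
  proof (cases k)
    case 0
    have "endpoint_sum \<alpha> \<beta> n (2 * int k - int (Suc n) - 1) = 0"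
      by (rule endpoint_sum_below) (simp add: 0)
    then show ?thesis unfolding endpoint_sum_Suc down Suc.IH by (simp add: 0)
  next
    case (Suc j)
    have up: "2 * int k - int (Suc n) - 1 = 2 * int j - int n" using Suc by simp
    show ?thesis
    proof (cases "k \<le> n")
      case True
      then have "n - j = Suc (n - k)" using Suc by simp
      then show ?thesis
        unfolding endpoint_sum_Suc up down Suc.IH using Suc by (simp add: algebra_simps)
    next
      case False
      then show ?thesis
        unfolding endpoint_sum_Suc up down Suc.IH using Suc by (simp add: binomial_eq_0)
    qed
  qed
qed

text \<open>Shifting the indicator of the positive integers by one changes it at a single point: an
  up step gains \<open>0\<close>, a down step loses \<open>1\<close>.\<close>

lemma positive_sum_Suc:
  "walk_sum \<alpha> \<beta> (Suc n) (\<lambda>z. of_bool (z \<ge> 1))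
     = (\<alpha> + \<beta>) * walk_sum \<alpha> \<beta> n (\<lambda>z. of_bool (z \<ge> 1))
       + \<beta> * endpoint_sum \<alpha> \<beta> n 0 - \<alpha> * endpoint_sum \<alpha> \<beta> n 1"
proof -
  have "(\<lambda>z::int. of_bool (z + 1 \<ge> 1)) = (\<lambda>z. of_bool (z \<ge> 1) + of_bool (z = 0) :: 'a)"
    "(\<lambda>z::int. of_bool (z - 1 \<ge> 1)) = (\<lambda>z. of_bool (z \<ge> 1) - of_bool (z = 1) :: 'a)"
    by (auto simp: fun_eq_iff)
  then show ?thesis by (simp only: walk_sum.simps walk_sum_add walk_sum_diff) (simp add: algebra_simps)
qed

lemma endpoint_sum_0: "endpoint_sum \<alpha> \<beta> (2 * m) 0 = of_nat ((2 * m) choose m) * (\<alpha> * \<beta>) ^ m"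
  using endpoint_sum_eq_binomial[of \<alpha> \<beta> "2 * m" m] by (simp add: power_mult_distrib mult_ac)

lemma central_binomial_double: "(2 * Suc m) choose Suc m = 2 * ((2 * m + 1) choose Suc m)"
proof -
  have "(2 * m + 1) choose m = (2 * m + 1) choose Suc m"
    using binomial_symmetric[of m "2 * m + 1"] by simp
  then show ?thesis by simp
qed

text \<open>By the reflection symmetry, half of the weight of the walks of length \<open>2m + 2\<close> that end at
  \<open>0\<close> comes from those whose last step goes down.\<close>
lemma positive_sum_rec:
  fixes \<alpha> \<beta> :: "'k::comm_ring_1"
  defines "S \<equiv> \<lambda>m. walk_sum \<alpha> \<beta> (2 * m) (\<lambda>z. of_bool (z \<ge> 1))"
  shows "2 * S (Suc m) = 2 * (\<alpha> + \<beta>)\<^sup>2 * S m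
           + 2 * (\<alpha> + \<beta>) * \<beta> * (of_nat ((2 * m) choose m) * (\<alpha> * \<beta>) ^ m)
           - of_nat ((2 * Suc m) choose Suc m) * (\<alpha> * \<beta>) ^ Suc m"
proof -
  let ?g = "\<lambda>z::int. of_bool (z \<ge> 1) :: 'k"
  \<comment> \<open>Two steps produce four boundary terms; parity removes two of them.\<close>
  have "endpoint_sum \<alpha> \<beta> (2 * m) 1 = 0" "endpoint_sum \<alpha> \<beta> (2 * m + 1) 0 = 0"
    by (rule endpoint_sum_odd; simp)+
  moreover have "2 * (\<alpha> * endpoint_sum \<alpha> \<beta> (2 * m + 1) 1)
                   = of_nat ((2 * Suc m) choose Suc m) * (\<alpha> * \<beta>) ^ Suc m"
    using endpoint_sum_eq_binomial[of \<alpha> \<beta> "2 * m + 1" "Suc m"]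
    unfolding central_binomial_double by (simp add: power_mult_distrib algebra_simps)
  moreover have "walk_sum \<alpha> \<beta> (2 * m + 1) ?g
      = (\<alpha> + \<beta>) * S m + \<beta> * endpoint_sum \<alpha> \<beta> (2 * m) 0 - \<alpha> * endpoint_sum \<alpha> \<beta> (2 * m) 1"
    using positive_sum_Suc[of \<alpha> \<beta> "2 * m"] by (simp only: S_def Suc_eq_plus1)
  moreover have "S (Suc m) = (\<alpha> + \<beta>) * walk_sum \<alpha> \<beta> (2 * m + 1) ?g
      + \<beta> * endpoint_sum \<alpha> \<beta> (2 * m + 1) 0 - \<alpha> * endpoint_sum \<alpha> \<beta> (2 * m + 1) 1"
    using positive_sum_Suc[of \<alpha> \<beta> "2 * m + 1"] by (simp add: S_def del: walk_sum.simps)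
  ultimately show ?thesis
    by (simp only: endpoint_sum_0) (simp add: algebra_simps power2_eq_square)
qed

section \<open>Even power series and the central binomial series\<close>

definition even_fps :: "(nat \<Rightarrow> 'k::comm_ring_1) \<Rightarrow> 'k fps" where
  "even_fps f = Abs_fps (\<lambda>n. if even n then f (n div 2) else 0)"

text \<open>Turns identities with factors \<open>1 - c X^2\<close> into first-order recurrences for
  the even coefficients, and back.\<close>

lemma even_fps_mult_quadratic:
  "even_fps f * (1 - fps_const c * fps_X\<^sup>2)
     = even_fps (\<lambda>m. f m - (case m of 0 \<Rightarrow> 0 | Suc k \<Rightarrow> c * f k))"
proof (rule fps_ext)
  fix n
  have "even_fps f * (1 - fps_const c * fps_X\<^sup>2) = even_fps f - fps_const c * (even_fps f * fps_X\<^sup>2)"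
    by (simp add: algebra_simps)
  then show "fps_nth (even_fps f * (1 - fps_const c * fps_X\<^sup>2)) n =
        fps_nth (even_fps (\<lambda>m. f m - (case m of 0 \<Rightarrow> 0 | Suc k \<Rightarrow> c * f k))) n"
    by (cases n; cases "n - 1") (auto simp: even_fps_def fps_X_power_mult_right_nth)
qed

lemma even_fps_diff: "even_fps f - even_fps g = even_fps (\<lambda>m. f m - g m)"
  and even_fps_cmult: "fps_const c * even_fps f = even_fps (\<lambda>m. c * f m)"
  and even_fps_delta: "even_fps (\<lambda>m. if m = 0 then 1 else 0) = 1"
  by (auto simp: even_fps_def fps_eq_iff)

text \<open>This is \<open>1 / sqrt (1 - 4 q X^2)\<close>, given by its coefficients so that no root
  has to be chosen in the coefficient ring.\<close>

definition central_fps :: "'k::comm_ring_1 \<Rightarrow> 'k fps" where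
  "central_fps q = even_fps (\<lambda>m. of_nat ((2 * m) choose m) * q ^ m)"

lemma central_binomial_Suc:
  "Suc m * ((2 * Suc m) choose Suc m) = 2 * (2 * m + 1) * ((2 * m) choose m)"
proof -
  have "Suc m * ((2 * m + 1) choose Suc m) = (2 * m + 1) * ((2 * m) choose m)"
    using Suc_times_binomial_eq[of "2 * m" m] by (simp add: mult.commute)
  then show ?thesis unfolding central_binomial_double by (simp add: algebra_simps)
qed

text \<open>With \<open>d = 1 - 4 q X^2\<close> the series satisfies \<open>C' d = 4 q X C\<close>,
  so the derivative of \<open>C^2 d\<close> vanishes, and its constant coefficient is
  \<open>1\<close>.\<close>

lemma central_fps_square:
  fixes q :: "'k::field_char_0"
  shows "(central_fps q)\<^sup>2 * (1 - fps_const (4 * q) * fps_X\<^sup>2) = 1"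
proof -
  define C where "C = central_fps q"
  define d where "d = 1 - fps_const (4 * q) * fps_X\<^sup>2"
  have nth: "fps_nth C (2 * m) = of_nat ((2 * m) choose m) * q ^ m" for m
    by (simp add: C_def central_fps_def even_fps_def)
  have ode: "fps_deriv C * d = fps_const (4 * q) * fps_X * C"
  proof (rule fps_ext)
    fix n
    have expand: "fps_deriv C * d
        = fps_deriv C - fps_const (4 * q) * (fps_deriv C * fps_X\<^sup>2)"
      "fps_const (4 * q) * fps_X * C = fps_const (4 * q) * (C * fps_X)"
      by (simp_all add: d_def algebra_simps)
    show "fps_nth (fps_deriv C * d) n = fps_nth (fps_const (4 * q) * fps_X * C) n"
    proof (cases "even n")
      case True
      then show ?thesis unfolding expand
        by (cases n; cases "n - 1")
          (auto simp: C_def central_fps_def even_fps_def fps_X_power_mult_right_nth)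
    next
      case False
      \<comment> \<open>Only the odd coefficients carry content; there the equation is the
        recurrence of the central binomial coefficients.\<close>
      then obtain m where n: "n = 2 * m + 1" by (elim oddE)
      have "of_nat (2 * m + 2) * fps_nth C (2 * Suc m)
              = 2 * q ^ Suc m * of_nat (Suc m * ((2 * Suc m) choose Suc m))"
        unfolding nth by (simp add: algebra_simps)
      also have "\<dots> = (8 * of_nat m + 4) * q * fps_nth C (2 * m)"
        unfolding central_binomial_Suc nth by (simp add: algebra_simps)
      finally have "of_nat (2 * m + 2) * fps_nth C (2 * Suc m)
              = (8 * of_nat m + 4) * q * fps_nth C (2 * m)" .
      then show ?thesis unfolding expand n
        by (cases m) (simp_all add: fps_X_power_mult_right_nth, simp_all add: algebra_simps numeral_2_eq_2)
    qed
  qed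
  have "fps_deriv d = - 2 * fps_const (4 * q) * fps_X"
    by (simp add: d_def power2_eq_square algebra_simps)
  then have "fps_deriv (C\<^sup>2 * d) = 2 * C * (fps_deriv C * d - fps_const (4 * q) * fps_X * C)"
    by (simp add: power2_eq_square algebra_simps)
  then have "fps_deriv (C\<^sup>2 * d) = 0" by (simp add: ode)
  moreover have "fps_nth (C\<^sup>2 * d) 0 = 1"
    by (simp add: d_def C_def central_fps_def even_fps_def power2_eq_square)
  ultimately have "C\<^sup>2 * d = 1"
    using fps_deriv_eq_0_iff[of "C\<^sup>2 * d"] by (simp del: fps_deriv_mult fps_mult_nth_0)
  then show ?thesis by (simp add: C_def d_def)
qed

text \<open>The recurrence \<open>positive_sum_rec\<close> as an identity of series. The constant
  \<open>1\<close> accounts for index \<open>0\<close>, where the walk sum is \<open>0\<close> and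
  the central coefficient is \<open>1\<close>.\<close>

lemma positive_fps:
  fixes \<alpha> \<beta> :: "'k::comm_ring_1"
  shows "2 * even_fps (\<lambda>m. walk_sum \<alpha> \<beta> (2 * m) (\<lambda>z. of_bool (z \<ge> 1)))
             * (1 - fps_const ((\<alpha> + \<beta>)\<^sup>2) * fps_X\<^sup>2)
           = 1 - central_fps (\<alpha> * \<beta>) * (1 - fps_const (2 * (\<alpha> + \<beta>) * \<beta>) * fps_X\<^sup>2)"
proof -
  have two: "2 * even_fps f = even_fps (\<lambda>m. 2 * f m)" for f :: "nat \<Rightarrow> 'k"
    by (simp add: numeral_fps_const even_fps_cmult)
  define S where "S = (\<lambda>m. walk_sum \<alpha> \<beta> (2 * m) (\<lambda>z. of_bool (z \<ge> 1)))"
  define c where "c = (\<lambda>m. of_nat ((2 * m) choose m) * (\<alpha> * \<beta>) ^ m)"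
  have "S 0 = 0" "c 0 = 1" by (simp_all add: S_def c_def)
  moreover have "2 * S (Suc m) = 2 * (\<alpha> + \<beta>)\<^sup>2 * S m + 2 * (\<alpha> + \<beta>) * \<beta> * c m - c (Suc m)" for m
    unfolding S_def c_def by (rule positive_sum_rec)
  ultimately have "even_fps (\<lambda>m. 2 * S m) * (1 - fps_const ((\<alpha> + \<beta>)\<^sup>2) * fps_X\<^sup>2)
      = even_fps (\<lambda>m. if m = 0 then 1 else 0)
        - even_fps c * (1 - fps_const (2 * (\<alpha> + \<beta>) * \<beta>) * fps_X\<^sup>2)"
    unfolding even_fps_mult_quadratic even_fps_diff
    by (intro arg_cong[where f = even_fps] ext) (simp add: algebra_simps split: nat.split)
  then show ?thesis
    by (simp only: even_fps_delta two[symmetric] central_fps_def S_def c_def)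
qed

subsection \<open>Dyck N-bridges\<close>

lemma sum_lists_Suc:
  assumes "finite S"
  shows "(\<Sum>w | length w = Suc n \<and> set w \<subseteq> S. f w)
           = (\<Sum>s\<in>S. \<Sum>w | length w = n \<and> set w \<subseteq> S. f (s # w))"
proof -
  have "{w. length w = Suc n \<and> set w \<subseteq> S}
          = (\<lambda>(s, w). s # w) ` (S \<times> {w. length w = n \<and> set w \<subseteq> S})"
    by (auto simp: length_Suc_conv image_iff)
  then show ?thesis
    by (simp add: sum.reindex inj_on_def sum.cartesian_product case_prod_unfold)
qed

text \<open>Steps with the same value of \<open>h\<close> merge into one classical step carrying the
  sum of their weights. It is applied with \<open>h = Min\<close> and with \<open>h\<close> the
  negated \<open>Max\<close>.\<close>

lemma sum_lists_eq_walk_sum: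
  fixes q :: "'s \<Rightarrow> 'k::comm_ring_1" and h :: "'s \<Rightarrow> int"
  assumes "finite S" and "\<And>s. s \<in> S \<Longrightarrow> h s \<in> {-1, 1}"
  shows "(\<Sum>w | length w = n \<and> set w \<subseteq> S. prod_list (map q w) * g (sum_list (map h w)))
           = walk_sum (\<Sum>s | s \<in> S \<and> h s = -1. q s) (\<Sum>s | s \<in> S \<and> h s = 1. q s) n g"
proof (induction n arbitrary: g)
  case 0
  have "{w. w = [] \<and> set w \<subseteq> S} = {[]}" by auto
  then show ?case by simp
next
  case (Suc n)
  let ?W = "\<lambda>g. walk_sum (\<Sum>s | s \<in> S \<and> h s = -1. q s) (\<Sum>s | s \<in> S \<and> h s = 1. q s) n g"
  have "(\<Sum>w | length w = Suc n \<and> set w \<subseteq> S. prod_list (map q w) * g (sum_list (map h w)))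
      = (\<Sum>s\<in>S. q s * (\<Sum>w | length w = n \<and> set w \<subseteq> S.
                      prod_list (map q w) * g (sum_list (map h w) + h s)))"
    by (simp add: sum_lists_Suc assms sum_distrib_left mult.assoc add.commute)
  also have "\<dots> = (\<Sum>s\<in>S. q s * ?W (\<lambda>z. g (z + h s)))"
    by (intro sum.cong refl arg_cong2[where f = "(*)"] Suc.IH)
  also have "\<dots> = (\<Sum>s | s \<in> S \<and> h s = 1. q s * ?W (\<lambda>z. g (z + h s)))
                + (\<Sum>s | s \<in> S \<and> h s = -1. q s * ?W (\<lambda>z. g (z + h s)))"
  proof (subst sum.union_disjoint[symmetric])
    have "S = {s \<in> S. h s = 1} \<union> {s \<in> S. h s = -1}" using assms by auto
    then show "(\<Sum>s\<in>S. q s * ?W (\<lambda>z. g (z + h s)))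
      = (\<Sum>s\<in>{s \<in> S. h s = 1} \<union> {s \<in> S. h s = -1}. q s * ?W (\<lambda>z. g (z + h s)))"
      by simp
  qed (use assms in auto)
  also have "\<dots> = walk_sum (\<Sum>s | s \<in> S \<and> h s = -1. q s) (\<Sum>s | s \<in> S \<and> h s = 1. q s) (Suc n) g"
    by (simp add: sum_distrib_right)
  finally show ?case .
qed

section \<open>Reachable points of Dyck N-walks\<close>

abbreviation low :: "nstep list \<Rightarrow> int" where "low w \<equiv> sum_list (map Min w)"
abbreviation high :: "nstep list \<Rightarrow> int" where "high w \<equiv> sum_list (map Max w)"

lemma reachable_Nil: "reachable [] = {0}"
  by (auto simp: reachable_def compatible_def walk_pos_def)

lemma reachable_Cons: "reachable (s # w) = {i + z | i z. i \<in> s \<and> z \<in> reachable w}"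
proof -
  have "compatible v (s # w) \<longleftrightarrow> (\<exists>i v'. v = i # v' \<and> i \<in> s \<and> compatible v' w)" for v
    by (simp add: compatible_def list_all2_Cons2)
  then show ?thesis by (auto simp: reachable_def walk_pos_def) (metis sum_list.Cons take_all order_refl)+
qed

text \<open>Induction on the first step: a singleton translates the set, and \<open>{-1, 1}\<close>
  widens it by one at both ends without leaving gaps in the new parity class.\<close>

lemma reachable_dyck:
  assumes "set w \<subseteq> dyck_nsteps"
  shows "low w \<le> high w \<and> even (low w + int (length w)) \<and> even (high w + int (length w))
    \<and> reachable w = {z. low w \<le> z \<and> z \<le> high w \<and> even (z + int (length w))}"
  using assms
proof (induction w)
  case Nil
  then show ?case by (auto simp: reachable_Nil)
next
  case (Cons s w)
  then have R: "reachable w = {z. low w \<le> z \<and> z \<le> high w \<and> even (z + int (length w))}"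
    and w: "low w \<le> high w" "even (low w + int (length w))" "even (high w + int (length w))"
    by auto
  from Cons.prems consider "s = {-1}" | "s = {1}" | "s = {-1, 1}"
    by (auto simp: dyck_nsteps_def)
  then show ?case
  proof cases
    case 3
    have "z \<in> reachable (s # w) \<longleftrightarrow> low w - 1 \<le> z \<and> z \<le> high w + 1 \<and> odd (z + int (length w))"
      for z
    proof -
      have "z \<in> reachable (s # w) \<longleftrightarrow> z + 1 \<in> reachable w \<or> z - 1 \<in> reachable w"
        unfolding reachable_Cons 3 by (auto, force, force) 
      also have "\<dots> \<longleftrightarrow> low w - 1 \<le> z \<and> z \<le> high w + 1 \<and> odd (z + int (length w))"
      proof (cases "odd (z + int (length w))")
        case True
        \<comment> \<open>If \<open>low w = high w\<close>, that point lies within the new bounds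
          while neither of its neighbours is reachable by \<open>w\<close>; parity excludes it as a
          value of \<open>z\<close>.\<close>
        then have "even (z + 1 + int (length w))" "even (z - 1 + int (length w))" "z \<noteq> low w"
          using w(2) by auto
        then show ?thesis unfolding R mem_Collect_eq using True w(1) by linarith
      next
        case False
        then show ?thesis unfolding R mem_Collect_eq by simp
      qed
      finally show ?thesis .
    qed
    then have "reachable (s # w)
        = {z. low w - 1 \<le> z \<and> z \<le> high w + 1 \<and> odd (z + int (length w))}"
      by blast
    then show ?thesis using w 3 by (simp add: add.commute)
  next
    case 1
    have "z \<in> reachable (s # w) \<longleftrightarrow> low w - 1 \<le> z \<and> z \<le> high w - 1 \<and> odd (z + int (length w))"
      for z
    proof -
      have "z \<in> reachable (s # w) \<longleftrightarrow> z + 1 \<in> reachable w"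
        unfolding reachable_Cons 1 by auto force
      moreover have "even (z + 1 + int (length w)) \<longleftrightarrow> odd (z + int (length w))" by presburger
      ultimately show ?thesis unfolding R mem_Collect_eq by linarith
    qed
    then have "reachable (s # w)
        = {z. low w - 1 \<le> z \<and> z \<le> high w - 1 \<and> odd (z + int (length w))}"
      by blast
    then show ?thesis using w 1 by simp
  next
    case 2
    have "z \<in> reachable (s # w) \<longleftrightarrow> low w + 1 \<le> z \<and> z \<le> high w + 1 \<and> odd (z + int (length w))"
      for z
    proof -
      have "z \<in> reachable (s # w) \<longleftrightarrow> z - 1 \<in> reachable w"
        unfolding reachable_Cons 2 by auto force
      moreover have "even (z - 1 + int (length w)) \<longleftrightarrow> odd (z + int (length w))" by presburger
      ultimately show ?thesis unfolding R mem_Collect_eq by linarith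
    qed
    then have "reachable (s # w)
        = {z. low w + 1 \<le> z \<and> z \<le> high w + 1 \<and> odd (z + int (length w))}"
      by blast
    then show ?thesis using w 2 by (simp add: add.commute)
  qed
qed

lemma
  assumes "set w \<subseteq> dyck_nsteps"
  shows min_reach_dyck: "min_reach w = low w"
    and max_reach_dyck: "max_reach w = high w"
    and nbridge_dyck_iff: "nbridge w \<longleftrightarrow> low w \<le> 0 \<and> 0 \<le> high w \<and> even (length w)"
proof -
  have le: "low w \<le> high w"
    and parity: "even (low w + int (length w))" "even (high w + int (length w))"
    and R: "reachable w = {z. low w \<le> z \<and> z \<le> high w \<and> even (z + int (length w))}"
    using reachable_dyck[OF assms] by blast+
  have fin: "finite (reachable w)"
    by (rule finite_subset[of _ "{low w..high w}"]) (auto simp: R)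
  have bounds: "low w \<le> z \<and> z \<le> high w" if "z \<in> reachable w" for z
    using that unfolding R by blast
  have "low w \<in> reachable w" "high w \<in> reachable w"
    unfolding R mem_Collect_eq using le parity by blast+
  with bounds show "min_reach w = low w" "max_reach w = high w"
    unfolding min_reach_def max_reach_def by (metis Min_eqI fin, metis Max_eqI fin)
  have "nbridge w \<longleftrightarrow> 0 \<in> reachable w"
    by (auto simp: nbridge_def bridge_def reachable_def)
  then show "nbridge w \<longleftrightarrow> low w \<le> 0 \<and> 0 \<le> high w \<and> even (length w)"
    unfolding R by simp
qed

section \<open>The bridge series in terms of classical walks\<close>

lemma prod_list_powi:
  fixes x :: "'k::field"
  assumes "x \<noteq> 0"
  shows "x powi sum_list (map f w) = prod_list (map (\<lambda>s. x powi f s) w)"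
  using assms by (induction w) (simp_all add: power_int_add)

lemma prod_list_mult:
  "prod_list (map f w) * prod_list (map g w) = prod_list (map (\<lambda>s. f s * g s) w :: 'k::comm_monoid_mult list)"
  by (induction w) (simp_all add: mult_ac)

lemma finite_dyck_nsteps: "finite dyck_nsteps"
  by (simp add: dyck_nsteps_def)

text \<open>From all walks of even length, those with positive minimum and those with negative
  maximum are removed. Following the minima, \<open>{-1}\<close> and \<open>{-1, 1}\<close> go down;
  following the negated maxima, \<open>{1}\<close> and \<open>{-1, 1}\<close> do.\<close>

lemma dyck_nbridge_gf_eq:
  fixes p :: "nstep \<Rightarrow> 'k::field" and x y :: 'k
  assumes "x \<noteq> 0" "y \<noteq> 0"
  defines "d \<equiv> p {-1} / (x * y)" and "u \<equiv> p {1} * (x * y)" and "e \<equiv> p {-1, 1} * (y / x)"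
  shows "dyck_nbridge_gf p x y = even_fps (\<lambda>m. (d + u + e) ^ (2 * m)
           - walk_sum (d + e) u (2 * m) (\<lambda>z. of_bool (z \<ge> 1))
           - walk_sum (u + e) d (2 * m) (\<lambda>z. of_bool (z \<ge> 1)))"
proof (rule fps_ext)
  fix n
  let ?S = dyck_nsteps
  let ?L = "{w. length w = n \<and> set w \<subseteq> ?S}"
  \<comment> \<open>Minimum and maximum are additive along a walk, so their monomials can be
    absorbed into the weights of the single steps.\<close>
  define q where "q = (\<lambda>s. p s * x powi Min s * y powi Max s)"
  have q: "q {-1} = d" "q {1} = u" "q {-1, 1} = e"
    using assms by (simp_all add: q_def d_def u_def e_def field_simps)
  have distinct: "{-1, 1::int} \<noteq> {1}" "{-1, 1::int} \<noteq> {-1}" by auto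
  have fin: "finite ?L" using finite_lists_length_eq[OF finite_dyck_nsteps] by (simp add: conj_commute)
  have sets: "{s \<in> ?S. Min s = -1} = {{-1}, {-1, 1}}" "{s \<in> ?S. Min s = 1} = {{1}}"
    "{s \<in> ?S. - Max s = -1} = {{1}, {-1, 1}}" "{s \<in> ?S. - Max s = 1} = {{-1}}"
    by (auto simp: dyck_nsteps_def)
  have low: "(\<Sum>w\<in>?L. prod_list (map q w) * g (low w)) = walk_sum (d + e) u n g" for g
  proof -
    have "Min s \<in> {-1, 1}" if "s \<in> ?S" for s using that by (auto simp: dyck_nsteps_def)
    with sum_lists_eq_walk_sum[OF finite_dyck_nsteps, where h = Min and q = q and n = n and g = g]
    show ?thesis unfolding sets using distinct by (simp add: q)
  qed
  have high: "(\<Sum>w\<in>?L. prod_list (map q w) * g (- high w)) = walk_sum (u + e) d n g" for g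
  proof -
    have "- Max s \<in> {-1, 1}" if "s \<in> ?S" for s using that by (auto simp: dyck_nsteps_def)
    with sum_lists_eq_walk_sum[OF finite_dyck_nsteps, where h = "\<lambda>s. - Max s" and q = q and n = n and g = g]
    show ?thesis unfolding sets using distinct by (simp add: q uminus_sum_list_map o_def)
  qed
  have "fps_nth (dyck_nbridge_gf p x y) n
          = (\<Sum>w\<in>?L. of_bool (nbridge w) * prod_list (map q w))"
    unfolding dyck_nbridge_gf_def nbridges_def fps_nth_Abs_fps
  proof (intro sum.mono_neutral_cong_left fin)
    fix w assume w: "w \<in> {w. length w = n \<and> set w \<subseteq> ?S \<and> nbridge w}"
    then have "set w \<subseteq> ?S" by simp
    then show "prod_list (map p w) * x powi min_reach w * y powi max_reach w
            = of_bool (nbridge w) * prod_list (map q w)"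
      using assms w by (simp add: min_reach_dyck max_reach_dyck prod_list_powi prod_list_mult q_def)
  qed auto
  \<comment> \<open>The two excluded cases are disjoint since \<open>low w \<le> high w\<close>. The
    factor \<open>1\<close> gives the total the shape of \<open>low\<close> with constant
    \<open>g\<close>.\<close>
  also have "\<dots> = (\<Sum>w\<in>?L. of_bool (even n) * (prod_list (map q w) * 1
       - prod_list (map q w) * of_bool (low w \<ge> 1) - prod_list (map q w) * of_bool (- high w \<ge> 1)))"
  proof (intro sum.cong refl)
    fix w assume "w \<in> ?L"
    then have "set w \<subseteq> ?S" and n: "length w = n" by auto
    then have "low w \<le> high w" "nbridge w \<longleftrightarrow> low w \<le> 0 \<and> 0 \<le> high w \<and> even n"
      using reachable_dyck nbridge_dyck_iff by auto
    then show "of_bool (nbridge w) * prod_list (map q w) = of_bool (even n) * (prod_list (map q w) * 1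
       - prod_list (map q w) * of_bool (low w \<ge> 1) - prod_list (map q w) * of_bool (- high w \<ge> 1))"
      by (auto simp: not_le)
  qed
  also have "\<dots> = of_bool (even n) * ((d + u + e) ^ n
           - walk_sum (d + e) u n (\<lambda>z. of_bool (z \<ge> 1)) - walk_sum (u + e) d n (\<lambda>z. of_bool (z \<ge> 1)))"
    unfolding sum_distrib_left[symmetric] sum_subtractf
    using low[of "\<lambda>_. 1"] low[of "\<lambda>z. of_bool (z \<ge> 1)"] high[of "\<lambda>z. of_bool (z \<ge> 1)"]
    by (simp add: walk_sum_1 algebra_simps)
  finally show "fps_nth (dyck_nbridge_gf p x y) n = fps_nth (even_fps (\<lambda>m. (d + u + e) ^ (2 * m)
           - walk_sum (d + e) u (2 * m) (\<lambda>z. of_bool (z \<ge> 1))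
           - walk_sum (u + e) d (2 * m) (\<lambda>z. of_bool (z \<ge> 1)))) n"
    by (auto simp: even_fps_def)
qed

text \<open>The total is the geometric series \<open>1 / (1 - \<sigma>^2 X^2)\<close>, and both walk
  sums have this same denominator because their two step weights add up to
  \<open>\<sigma>\<close>.\<close>

lemma dyck_nbridge_gf_central:
  fixes p :: "nstep \<Rightarrow> 'k::field" and x y :: 'k
  assumes "x \<noteq> 0" "y \<noteq> 0"
  defines "d \<equiv> p {-1} / (x * y)" and "u \<equiv> p {1} * (x * y)" and "e \<equiv> p {-1, 1} * (y / x)"
  shows "2 * dyck_nbridge_gf p x y * (1 - fps_const ((d + u + e)\<^sup>2) * fps_X\<^sup>2)
    = central_fps (u * (d + e)) * (1 - fps_const (2 * (d + u + e) * u) * fps_X\<^sup>2)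
      + central_fps (d * (u + e)) * (1 - fps_const (2 * (d + u + e) * d) * fps_X\<^sup>2)"
proof -
  let ?\<sigma> = "d + u + e"
  let ?E = "1 - fps_const (?\<sigma>\<^sup>2) * fps_X\<^sup>2"
  define T where "T = even_fps (\<lambda>m. ?\<sigma> ^ (2 * m))"
  define P where "P = (\<lambda>\<alpha> \<beta>. even_fps (\<lambda>m. walk_sum \<alpha> \<beta> (2 * m) (\<lambda>z. of_bool (z \<ge> 1)) :: 'k))"
  have "T * ?E = 1"
    unfolding T_def even_fps_mult_quadratic
    by (subst even_fps_delta[symmetric], intro arg_cong[where f = even_fps] ext)
      (simp add: power2_eq_square mult.assoc split: nat.split)
  have up: "2 * P (d + e) u * ?E
      = 1 - central_fps (u * (d + e)) * (1 - fps_const (2 * ?\<sigma> * u) * fps_X\<^sup>2)"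
    using positive_fps[of "d + e" u] by (simp add: P_def add_ac mult.commute[of u])
  have down: "2 * P (u + e) d * ?E
      = 1 - central_fps (d * (u + e)) * (1 - fps_const (2 * ?\<sigma> * d) * fps_X\<^sup>2)"
    using positive_fps[of "u + e" d] by (simp add: P_def add_ac mult.commute[of d])
  have gf: "dyck_nbridge_gf p x y = T - P (d + e) u - P (u + e) d"
    unfolding d_def u_def e_def dyck_nbridge_gf_eq[OF assms(1,2)] T_def P_def even_fps_diff ..
  have "2 * dyck_nbridge_gf p x y * ?E
      = 2 * (T * ?E) - 2 * P (d + e) u * ?E - 2 * P (u + e) d * ?E"
    unfolding gf by (simp add: algebra_simps)
  then show ?thesis unfolding \<open>T * ?E = 1\<close> up down by simp
qed

section \<open>The algebraic degree of the weighted series\<close>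

lemma fps_of_poly_quadratic:
  fixes m :: "'k::comm_ring_1"
  shows "fps_of_poly [:1, 0, - m:] = 1 - fps_const m * fps_X\<^sup>2"
  by (simp add: fps_of_poly_pCons fps_of_poly_const power2_eq_square algebra_simps
      flip: fps_const_neg)

text \<open>An inverse square root times its radicand is the square root itself, which has a
  polynomial square as the degree criteria require.\<close>

lemma sqrt_of_central_fps:
  fixes q :: "'k::field_char_0"
  shows "(central_fps q * fps_of_poly [:1, 0, - (4 * q):])\<^sup>2 = fps_of_poly [:1, 0, - (4 * q):]"
  using central_fps_square[of q]
  by (simp only: fps_of_poly_quadratic power_mult_distrib power2_eq_square[of "1 - _"] mult.assoc[symmetric])
    simp

text \<open>Multiplying the formula by \<open>d1 * d2\<close> turns the inverse roots into roots
  \<open>D1\<close>, \<open>D2\<close>. The last three assumptions make \<open>d1\<close>,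
  \<open>d2\<close> and \<open>d1 * d2\<close> nonsquares.\<close>

lemma dyck_nbridge_gf_degree_4:
  fixes p :: "nstep \<Rightarrow> 'k::field_char_0" and x y :: 'k
  assumes "x \<noteq> 0" "y \<noteq> 0"
  defines "d \<equiv> p {-1} / (x * y)" and "u \<equiv> p {1} * (x * y)" and "e \<equiv> p {-1, 1} * (y / x)"
  assumes nz: "u * (d + e) \<noteq> 0" "d * (u + e) \<noteq> 0" and ne: "u * (d + e) \<noteq> d * (u + e)"
  shows "algebraic_of_degree (dyck_nbridge_gf p x y) 4"
proof -
  let ?\<sigma> = "d + u + e"
  let ?Q = "\<lambda>m. [:1, 0, - m:] :: 'k poly"
  define d1 d2 where "d1 = ?Q (4 * (u * (d + e)))" and "d2 = ?Q (4 * (d * (u + e)))"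
  define D1 D2 where "D1 = central_fps (u * (d + e)) * fps_of_poly d1"
    and "D2 = central_fps (d * (u + e)) * fps_of_poly d2"
  have D: "D1\<^sup>2 = fps_of_poly d1" "D2\<^sup>2 = fps_of_poly d2"
    unfolding D1_def D2_def d1_def d2_def by (rule sqrt_of_central_fps)+
  have nonsquare: "d1 \<noteq> c\<^sup>2" "d2 \<noteq> c\<^sup>2" "d1 * d2 \<noteq> c\<^sup>2" for c
    unfolding d1_def d2_def using nz ne
    by (intro not_square_quadratic not_square_quadratic_product; simp)+
  have gf: "2 * dyck_nbridge_gf p x y * fps_of_poly (?Q (?\<sigma>\<^sup>2))
    = central_fps (u * (d + e)) * fps_of_poly (?Q (2 * ?\<sigma> * u))
      + central_fps (d * (u + e)) * fps_of_poly (?Q (2 * ?\<sigma> * d))"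
    unfolding fps_of_poly_quadratic d_def u_def e_def by (rule dyck_nbridge_gf_central[OF assms(1,2)])
  have "fps_of_poly (2 * ?Q (?\<sigma>\<^sup>2) * d1 * d2) * dyck_nbridge_gf p x y
    = (2 * dyck_nbridge_gf p x y * fps_of_poly (?Q (?\<sigma>\<^sup>2))) * fps_of_poly d1 * fps_of_poly d2"
    by (simp only: fps_of_poly_mult fps_of_poly_numeral mult_ac)
  also have "\<dots> = fps_of_poly (?Q (2 * ?\<sigma> * u) * d2) * D1 + fps_of_poly (?Q (2 * ?\<sigma> * d) * d1) * D2"
    unfolding gf D1_def D2_def fps_of_poly_mult by (simp only: distrib_left distrib_right mult_ac)
  finally have eq: "fps_of_poly (2 * ?Q (?\<sigma>\<^sup>2) * d1 * d2) * dyck_nbridge_gf p x y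
    = fps_of_poly (?Q (2 * ?\<sigma> * u) * d2) * D1 + fps_of_poly (?Q (2 * ?\<sigma> * d) * d1) * D2" .
  have Q_nz: "?Q m \<noteq> 0" for m by simp
  have "d1 \<noteq> 0" "d2 \<noteq> 0" "(2 :: 'k poly) \<noteq> 0" by (simp_all add: d1_def d2_def)
  then show ?thesis
    by (intro algebraic_of_degree_4I[OF D nonsquare _ _ _ eq] no_zero_divisors Q_nz)
qed

text \<open>Here \<open>u (d + e) = a b + b c y^2\<close> and
  \<open>d (u + e) = a b + a c / x^2\<close>, with \<open>a\<close>, \<open>b\<close>,
  \<open>c\<close> the weights of \<open>{-1}\<close>, \<open>{1}\<close>, \<open>{-1, 1}\<close>:
  both are nonzero, and only the first involves \<open>y\<close>.\<close>

lemma dyck_nbridge_gf_ratfun_degree_4: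
  fixes p :: "nstep \<Rightarrow> 'a::field_char_0"
  assumes "p {-1} \<noteq> 0" and "p {1} \<noteq> 0" and "p {-1, 1} \<noteq> 0"
  shows "algebraic_of_degree (dyck_nbridge_gf (\<lambda>s. rf_const (p s)) rf_x rf_y) 4"
proof (rule dyck_nbridge_gf_degree_4)
  define a b c where "a = p {-1}" and "b = p {1}" and "c = p {-1, 1}"
  define A B C where "A = rf_const a" and "B = rf_const b" and "C = rf_const c"
  define X Y where "X = (rf_x :: 'a ratfun2)" and "Y = (rf_y :: 'a ratfun2)"
  have X: "X \<noteq> 0" and Y: "Y \<noteq> 0" by (simp_all add: X_def Y_def rf_x_def rf_y_def)
  then show "(rf_x :: 'a ratfun2) \<noteq> 0" "(rf_y :: 'a ratfun2) \<noteq> 0" by (simp_all add: X_def Y_def)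
  have up: "B * (X * Y) * (A / (X * Y) + C * (Y / X)) = B * A + B * C * Y\<^sup>2"
    using X Y by (simp add: field_simps power2_eq_square)
  have down: "A / (X * Y) * (B * (X * Y) + C * (Y / X)) = (A * B * X\<^sup>2 + A * C) / X\<^sup>2"
    using X Y by (simp add: field_simps power2_eq_square)
  have poly_up: "B * A + B * C * Y\<^sup>2 = to_fract [:[:b * a:], 0, [:b * c:]:]"
    unfolding A_def B_def C_def Y_def rf_const_def rf_y_def power2_eq_square
      to_fract_mult[symmetric] to_fract_add[symmetric] to_fract_eq_iff by simp
  \<comment> \<open>The factor \<open>X^2\<close> clears the denominator, so that both quantities
    can be compared as polynomials in \<open>y\<close> over polynomials in \<open>x\<close>.\<close>
  have poly_up': "(B * A + B * C * Y\<^sup>2) * X\<^sup>2 = to_fract [:[:0, 0, b * a:], 0, [:0, 0, b * c:]:]"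
    unfolding poly_up unfolding X_def rf_x_def power2_eq_square to_fract_mult[symmetric] to_fract_eq_iff by simp
  have poly_down: "A * B * X\<^sup>2 + A * C = to_fract [:[:a * c, 0, a * b:]:]"
    unfolding A_def B_def C_def X_def rf_const_def rf_x_def power2_eq_square
      to_fract_mult[symmetric] to_fract_add[symmetric] to_fract_eq_iff by simp
  note [folded a_def b_def c_def, simp] = assms
  show "rf_const (p {1}) * (rf_x * rf_y) * (rf_const (p {-1}) / (rf_x * rf_y)
          + rf_const (p {-1, 1}) * (rf_y / rf_x)) \<noteq> 0"
    unfolding a_def[symmetric] b_def[symmetric] c_def[symmetric] A_def[symmetric] B_def[symmetric]
      C_def[symmetric] X_def[symmetric] Y_def[symmetric] up poly_up by simp
  show "rf_const (p {-1}) / (rf_x * rf_y) * (rf_const (p {1}) * (rf_x * rf_y)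
          + rf_const (p {-1, 1}) * (rf_y / rf_x)) \<noteq> 0"
    unfolding a_def[symmetric] b_def[symmetric] c_def[symmetric] A_def[symmetric] B_def[symmetric]
      C_def[symmetric] X_def[symmetric] Y_def[symmetric] down poly_down using X by simp
  have "B * A + B * C * Y\<^sup>2 \<noteq> (A * B * X\<^sup>2 + A * C) / X\<^sup>2"
    unfolding nonzero_eq_divide_eq[OF power_not_zero[OF X]] poly_up' poly_down to_fract_eq_iff by simp
  then show "rf_const (p {1}) * (rf_x * rf_y) * (rf_const (p {-1}) / (rf_x * rf_y)
          + rf_const (p {-1, 1}) * (rf_y / rf_x))
      \<noteq> rf_const (p {-1}) / (rf_x * rf_y) * (rf_const (p {1}) * (rf_x * rf_y)
          + rf_const (p {-1, 1}) * (rf_y / rf_x))"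
    unfolding a_def[symmetric] b_def[symmetric] c_def[symmetric] A_def[symmetric] B_def[symmetric]
      C_def[symmetric] X_def[symmetric] Y_def[symmetric] up down .
qed

subsection \<open>Growth of the number of bridges\<close>

text \<open>The coefficients of \<open>1 / sqrt (1 - 8 z)\<close>, that is,
  \<open>central_fps q\<close> at \<open>q = 2\<close> with \<open>z = X^2\<close>.\<close>

definition central_coeff :: "nat \<Rightarrow> real" where
  "central_coeff m = real ((2 * m) choose m) * 2 ^ m"

lemma central_coeff_0: "central_coeff 0 = 1"
  by (simp add: central_coeff_def)

lemma central_coeff_pos: "central_coeff m > 0"
  by (simp add: central_coeff_def)

lemma central_coeff_Suc:
  "central_coeff (Suc m) = (8 - 4 / (real m + 1)) * central_coeff m"
proof -
  have "real (Suc m * ((2 * Suc m) choose Suc m)) = real (2 * (2 * m + 1) * ((2 * m) choose m))"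
    unfolding central_binomial_Suc ..
  then have "real ((2 * Suc m) choose Suc m)
               = (8 - 4 / (real m + 1)) / 2 * real ((2 * m) choose m)"
    by (simp add: field_simps del: binomial_Suc_Suc)
  then show ?thesis by (simp add: central_coeff_def del: binomial_Suc_Suc)
qed

text \<open>\<open>U n\<close> is the reciprocal of the \<open>n\<close>-th Wallis product and
  decreases to \<open>2 / pi\<close>; \<open>L n\<close> is \<open>U n\<close> times
  \<open>n / (2 n + 1)\<close> and increases to \<open>1 / pi\<close>.\<close>

lemma central_coeff_squeeze:
  fixes m :: nat
  assumes "m > 0"
  defines "\<beta> \<equiv> central_coeff m / 8 ^ m"
  shows "\<beta>\<^sup>2 \<le> 1 / (pi * m)" and "1 / (pi * (m + 1 / 2)) \<le> \<beta>\<^sup>2"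
proof -
  define b where "b = (\<lambda>n. central_coeff n / 8 ^ n)"
  define U where "U = (\<lambda>n. (2 * real n + 1) * (b n)\<^sup>2)"
  define L where "L = (\<lambda>n. real n * (b n)\<^sup>2)"
  have b_Suc: "b (Suc n) = (2 * real n + 1) / (2 * real n + 2) * b n" for n
    unfolding b_def central_coeff_Suc by (simp add: divide_simps) (simp add: algebra_simps)
  have U_Suc: "U (Suc n) = U n * ((4 * (real n + 1)\<^sup>2 - 1) / (4 * (real n + 1)\<^sup>2))" for n
    unfolding U_def b_Suc
    by (simp add: power_divide power_mult_distrib divide_simps) (simp add: power2_eq_square algebra_simps)
  have "(\<Prod>k=1..n. (4 * real k ^ 2) / (4 * real k ^ 2 - 1)) = 1 / U n" for n
  proof (induction n)
    case 0
    then show ?case by (simp add: U_def b_def central_coeff_0)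
  next
    case (Suc n)
    then show ?case by (simp add: U_Suc add.commute)
  qed
  then have "(\<lambda>n. 1 / U n) \<longlonglongrightarrow> pi / 2" using wallis by simp
  from tendsto_inverse[OF this] have U: "U \<longlonglongrightarrow> 2 / pi" by simp
  have U_nonneg: "U n \<ge> 0" for n by (simp add: U_def)
  have "decseq U"
  proof (rule decseq_SucI)
    fix n
    have frac: "0 \<le> (4 * a - 1) / (4 * a)" "(4 * a - 1) / (4 * a) \<le> 1" if "1 \<le> a" for a :: real
      using that by (auto simp: field_simps)
    have "1 \<le> (real n + 1)\<^sup>2" by (simp add: one_le_power)
    then show "U (Suc n) \<le> U n"
      unfolding U_Suc by (intro mult_right_le_one_le frac U_nonneg)
  qed
  then have "2 / pi \<le> U m" using U by (rule decseq_ge)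
  then have "2 / pi / (2 * m + 1) \<le> \<beta>\<^sup>2"
    by (simp add: U_def b_def \<beta>_def pos_divide_le_eq ac_simps)
  moreover have "1 / (pi * (m + 1 / 2)) = 2 / pi / (2 * m + 1)" by (simp add: divide_simps)
  ultimately show "1 / (pi * (m + 1 / 2)) \<le> \<beta>\<^sup>2" by simp
  have "(\<lambda>n. real n / (2 * real n + 1)) \<longlonglongrightarrow> 1 / 2" by real_asymp
  note tendsto_mult[OF U this]
  moreover have "(\<lambda>n. U n * (real n / (2 * real n + 1))) = L"
  proof
    fix n
    have "2 * real n + 1 \<noteq> 0" by linarith
    then show "U n * (real n / (2 * real n + 1)) = L n" by (simp add: U_def L_def)
  qed
  ultimately have "L \<longlonglongrightarrow> 1 / pi" by simp
  moreover have "incseq L"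
  proof (rule incseq_SucI)
    fix n
    \<comment> \<open>This amounts to \<open>4 n (n + 1) \<le> (2 n + 1)^2\<close>.\<close>
    have "real n \<le> (real n + 1) * ((2 * real n + 1) / (2 * real n + 2))\<^sup>2"
      by (simp add: power_divide divide_simps) (simp add: power2_eq_square algebra_simps)
    then show "L n \<le> L (Suc n)"
      unfolding L_def b_Suc power_mult_distrib
      by (metis mult.assoc mult_right_mono of_nat_Suc add.commute zero_le_power2)
  qed
  ultimately have "L m \<le> 1 / pi" by (rule incseq_le[rotated])
  then show "\<beta>\<^sup>2 \<le> 1 / (pi * m)"
    using assms by (simp add: L_def b_def field_simps)
qed

text \<open>Passes from the squares to the coefficients by \<open>(t - b) t \<le> t^2 - b^2\<close>;
  the squares differ by at most \<open>t^2 / (2 m)\<close>.\<close>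

lemma central_coeff_approx:
  assumes "m > 0"
  defines "t \<equiv> 1 / sqrt (pi * real m)"
  shows "central_coeff m \<le> 8 ^ m * t" and "8 ^ m * (t - t / (2 * real m)) \<le> central_coeff m"
proof -
  define b where "b = central_coeff m / 8 ^ m"
  note sq = central_coeff_squeeze[OF assms(1), folded b_def]
  have "t > 0" "b > 0" using assms by (simp_all add: t_def b_def central_coeff_pos)
  have t2: "t\<^sup>2 = 1 / (pi * real m)" using assms by (simp add: t_def power_divide)
  have "b\<^sup>2 \<le> t\<^sup>2" unfolding t2 by (rule sq(1))
  then have "b \<le> t" using \<open>t > 0\<close> by (rule power2_le_imp_le[OF _ less_imp_le])
  have "(t - b) * t \<le> (t - b) * (t + b)"
    using \<open>b \<le> t\<close> \<open>b > 0\<close> by (intro mult_left_mono) auto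
  also have "\<dots> = t\<^sup>2 - b\<^sup>2" by (simp add: power2_eq_square algebra_simps)
  also have "\<dots> \<le> 1 / (pi * m) - 1 / (pi * (m + 1 / 2))" using sq t2 by simp
  also have "\<dots> \<le> 1 / (pi * m) / (2 * m)" using assms by (simp add: divide_simps)
  also have "\<dots> = t / (2 * m) * t" unfolding t2[symmetric] by (simp add: power2_eq_square)
  finally have "t - b \<le> t / (2 * m)" using \<open>t > 0\<close> by (rule mult_right_le_imp_le)
  with \<open>b \<le> t\<close> show "central_coeff m \<le> 8 ^ m * t"
    "8 ^ m * (t - t / (2 * real m)) \<le> central_coeff m"
    by (simp_all add: b_def field_simps)
qed

text \<open>The binomial series of \<open>(1 + z) powr (- 1 / 2)\<close> at
  \<open>z = - 8 / 9\<close>.\<close>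

lemma central_coeff_sums: "(\<lambda>n. central_coeff n / 9 ^ n) sums 3"
proof -
  have "((- 1 / 2) gchoose n) * (- 8 / 9) ^ n = central_coeff n / 9 ^ n" for n
  proof (induction n)
    case (Suc n)
    have "real (Suc n) * ((- 1 / 2) gchoose Suc n) = (- 1 / 2 - real n) * ((- 1 / 2) gchoose n)"
      using gbinomial_mult_1[of "- 1 / 2 :: real" n] by (simp add: algebra_simps)
    then have "((- 1 / 2) gchoose Suc n)
        = (- 1 / 2 - real n) / (real n + 1) * ((- 1 / 2) gchoose n)"
      by (simp add: field_simps)
    then have "((- 1 / 2) gchoose Suc n) * (- 8 / 9) ^ Suc n
        = (- 1 / 2 - real n) / (real n + 1) * (- 8 / 9) * (((- 1 / 2) gchoose n) * (- 8 / 9) ^ n)"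
      by simp
    then show ?case unfolding Suc.IH central_coeff_Suc
      by (simp add: divide_simps) (simp add: algebra_simps)
  qed (simp add: central_coeff_0)
  moreover have "(\<lambda>n. ((- 1 / 2) gchoose n) * (- 8 / 9 :: real) ^ n) sums (1 + - 8 / 9) powr (- 1 / 2)"
    by (rule gen_binomial_real) simp
  moreover have "(1 / 9 :: real) powr (- 1 / 2) = 3"
  proof -
    have "(1 / 9 :: real) powr (- 1 / 2) = ((1 / 3) powr 2) powr (- 1 / 2)"
      by (simp add: power2_eq_square)
    also have "\<dots> = 3" unfolding powr_powr by (simp add: powr_minus)
    finally show ?thesis .
  qed
  ultimately show ?thesis by simp
qed

text \<open>After division by \<open>9 ^ m\<close>, the error \<open>e\<close> decreases to
  \<open>0\<close> and the corrected error \<open>f\<close> increases to \<open>0\<close>, which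
  fixes both signs.\<close>

lemma bridge_count_estimate:
  fixes b :: "nat \<Rightarrow> real"
  assumes b0: "b 0 = 1"
    and b_Suc: "\<And>m. b (Suc m) = 9 * b m + central_coeff (Suc m) - 6 * central_coeff m"
  shows "0 \<le> b m - 9 ^ m + 2 * central_coeff m"
    and "b m - 9 ^ m + 2 * central_coeff m \<le> 12 * central_coeff m / (real m + 1)"
proof -
  define r where "r = (\<lambda>m. central_coeff m / 9 ^ m)"
  define e where "e = (\<lambda>m. b m / 9 ^ m - 1 + 2 * r m)"
  \<comment> \<open>The constant \<open>12\<close> solves \<open>K - 4 / 3 = 8 / 9 * K\<close>: the
    drop of \<open>e\<close> is \<open>4 / 3\<close> times \<open>r m / (m + 1)\<close>, and that
    quotient shrinks at least by the factor \<open>8 / 9\<close>.\<close>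
  define f where "f = (\<lambda>m. e m - 12 * (r m / (real m + 1)))"
  have r_pos: "r m > 0" for m by (simp add: r_def central_coeff_pos)
  have r_Suc: "r (Suc m) = (8 - 4 / (real m + 1)) / 9 * r m" for m
    by (simp add: r_def central_coeff_Suc)
  have b_r: "b (Suc m) / 9 ^ Suc m = b m / 9 ^ m + r (Suc m) - 2 / 3 * r m" for m
    unfolding b_Suc r_def by (simp add: field_simps)
  \<comment> \<open>The recurrence unrolled. As the series of \<open>r\<close> sums to
    \<open>3\<close>, the right-hand side tends to \<open>1\<close>, the coefficient of
    \<open>9 ^ m\<close>.\<close>
  have "b m / 9 ^ m = 2 / 3 * r m + 1 / 3 * (\<Sum>k\<le>m. r k)" for m
  proof (induction m)
    case 0
    then show ?case by (simp add: b0 r_def central_coeff_0)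
  next
    case (Suc m)
    then show ?case unfolding b_r by (simp add: field_simps)
  qed
  then have e_eq: "e = (\<lambda>m. 8 / 3 * r m + 1 / 3 * (\<Sum>k\<le>m. r k) - 1)"
    by (simp add: e_def fun_eq_iff)
  have sum_r: "(\<lambda>m. \<Sum>k\<le>m. r k) \<longlonglongrightarrow> 3"
    using central_coeff_sums by (simp add: r_def sums_def_le)
  have r_lim: "r \<longlonglongrightarrow> 0"
    using central_coeff_sums unfolding r_def by (intro summable_LIMSEQ_zero sums_summable)
  have "e \<longlonglongrightarrow> 8 / 3 * 0 + 1 / 3 * 3 - 1"
    unfolding e_eq by (intro tendsto_intros r_lim sum_r)
  then have e_lim: "e \<longlonglongrightarrow> 0" by simp
  have "(\<lambda>m. r m * (1 / (real m + 1))) \<longlonglongrightarrow> 0 * 0"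
    by (intro tendsto_mult r_lim) real_asymp
  from tendsto_diff[OF e_lim tendsto_mult_left[OF this, of 12]] have f_lim: "f \<longlonglongrightarrow> 0"
    by (simp add: f_def)
  have e_Suc: "e (Suc m) = e m - 4 / 3 * (r m / (real m + 1))" for m
  proof -
    have "3 * r (Suc m) = 8 / 3 * r m - 4 / 3 * (r m / (real m + 1))"
      unfolding r_Suc by (simp add: divide_simps) (simp add: algebra_simps)
    then show ?thesis unfolding e_def b_r by simp
  qed
  have "decseq e"
    by (rule decseq_SucI) (simp add: e_Suc r_pos less_imp_le)
  then have "0 \<le> e m" using e_lim by (rule decseq_ge)
  then show "0 \<le> b m - 9 ^ m + 2 * central_coeff m"
    by (simp add: e_def r_def field_simps)
  have "incseq f"
  proof (rule incseq_SucI)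
    fix m
    have "r (Suc m) / (real m + 2) \<le> (8 / 9 * r m) / (real m + 1)"
      using r_pos[of m] r_pos[of "Suc m"] unfolding r_Suc
      by (intro frac_le) (auto simp: divide_simps)
    then have le: "r (Suc m) / (real m + 2) \<le> 8 / 9 * (r m / (real m + 1))" by simp
    have shift: "real (Suc m) + 1 = real m + 2" by simp
    show "f m \<le> f (Suc m)" unfolding f_def e_Suc shift using le by linarith
  qed
  then have "f m \<le> 0" using f_lim by (rule incseq_le)
  then show "b m - 9 ^ m + 2 * central_coeff m \<le> 12 * central_coeff m / (real m + 1)"
  proof -
    have "9 ^ m * f m = b m - 9 ^ m + 2 * central_coeff m - 12 * central_coeff m / (real m + 1)"
    proof -
      have "9 ^ m * f m = 9 ^ m * e m - 12 * (9 ^ m * r m) / (real m + 1)"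
        unfolding f_def by (simp add: right_diff_distrib)
      moreover have "9 ^ m * r m = central_coeff m" by (simp add: r_def)
      moreover have "9 ^ m * e m = b m - 9 ^ m + 2 * (9 ^ m * r m)"
        unfolding e_def by (simp add: right_diff_distrib distrib_left)
      ultimately show ?thesis by simp
    qed
    moreover have "9 ^ m * f m \<le> 0" using \<open>f m \<le> 0\<close> by (simp add: mult_nonneg_nonpos)
    ultimately show ?thesis by simp
  qed
qed

text \<open>The constant is \<open>12 + 1\<close>: \<open>12\<close> from
  \<open>bridge_count_estimate\<close>, and \<open>1\<close> from twice the relative error
  \<open>1 / (2 m)\<close> in \<open>central_coeff_approx\<close>.\<close>

lemma bridge_count_asymptotics:
  fixes b :: "nat \<Rightarrow> real"
  assumes "b 0 = 1"
    and "\<And>m. b (Suc m) = 9 * b m + central_coeff (Suc m) - 6 * central_coeff m"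
    and "m > 0"
  shows "\<bar>b m - 9 ^ m + 2 * 8 ^ m / sqrt (pi * m)\<bar> \<le> 13 * 8 ^ m / (sqrt (pi * m) * m)"
proof -
  define t where "t = 1 / sqrt (pi * m)"
  have "t > 0" using assms by (simp add: t_def)
  note e = bridge_count_estimate[OF assms(1,2), of m]
  note c = central_coeff_approx[OF assms(3), folded t_def]
  have "12 * central_coeff m / (real m + 1) \<le> 12 * (8 ^ m * t) / real m"
    using c(1) assms central_coeff_pos[of m] by (intro frac_le) auto
  moreover have "8 ^ m * (t - t / (2 * real m)) = 8 ^ m * t - (8 ^ m * t) / real m / 2"
    by (simp add: field_simps)
  moreover have "0 \<le> 8 ^ m * t / m" using \<open>t > 0\<close> by simp
  ultimately have "\<bar>b m - 9 ^ m + 2 * (8 ^ m * t)\<bar> \<le> 13 * (8 ^ m * t / real m)"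
    using e c by simp
  then show ?thesis by (simp add: t_def)
qed

section \<open>The unweighted series\<close>

lemma unweighted_gf:
  "dyck_nbridge_gf (\<lambda>_. 1) 1 1 * (1 - fps_const 9 * fps_X\<^sup>2)
     = central_fps (2 :: 'k::field_char_0) * (1 - fps_const 6 * fps_X\<^sup>2)"
proof -
  \<comment> \<open>For \<open>d = u = e = 1\<close> the two summands of the general formula
    coincide, and the factor 2 cancels.\<close>
  have "2 * (dyck_nbridge_gf (\<lambda>_. 1) 1 1 * (1 - fps_const 9 * fps_X\<^sup>2))
     = 2 * (central_fps (2 :: 'k) * (1 - fps_const 6 * fps_X\<^sup>2))"
    using dyck_nbridge_gf_central[of 1 1 "\<lambda>_. 1 :: 'k"] by (simp add: mult.assoc)
  then show ?thesis by simp
qed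

lemma unweighted_gf_degree_2: "algebraic_of_degree (dyck_nbridge_gf (\<lambda>_. 1) 1 1 :: 'k::field_char_0 fps) 2"
proof (rule algebraic_of_degree_2I)
  let ?Q = "\<lambda>m. [:1, 0, - m:] :: 'k poly"
  show "(central_fps 2 * fps_of_poly (?Q (4 * 2)))\<^sup>2 = fps_of_poly (?Q (4 * 2))"
    by (rule sqrt_of_central_fps)
  show "?Q (4 * 2) \<noteq> c\<^sup>2" for c by (rule not_square_quadratic) simp
  show "fps_of_poly (?Q 9 * ?Q (4 * 2)) * dyck_nbridge_gf (\<lambda>_. 1) 1 1
          = fps_of_poly (?Q 6) * (central_fps 2 * fps_of_poly (?Q (4 * 2)))"
    using arg_cong[OF unweighted_gf[where ?'k = 'k], of "\<lambda>f. f * fps_of_poly (?Q (4 * 2))"]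
    by (simp only: fps_of_poly_mult fps_of_poly_quadratic mult_ac)
qed simp_all

text \<open>A square root with prescribed constant coefficient is unique, so
  \<open>central_fps 2 * d\<close> is the formal radical \<open>R\<close>, and
  \<open>central_fps 2\<close> is its inverse.\<close>

lemma unweighted_gf_closed_form:
  "dyck_nbridge_gf (\<lambda>_. 1) 1 1
     = (1 - 6 * fps_X ^ 2) / (fps_radical root 2 (1 - 8 * fps_X ^ 2) * (1 - 9 * fps_X ^ 2))"
proof -
  let ?B = "dyck_nbridge_gf (\<lambda>_. 1) 1 1 :: real fps"
  define d :: "real fps" where "d = 1 - 8 * fps_X ^ 2"
  define R where "R = fps_radical root 2 d"
  have C: "(central_fps 2)\<^sup>2 * d = 1"
    using central_fps_square[of "2 :: real"] by (simp add: d_def numeral_fps_const)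
  have "(central_fps 2 * d) ^ Suc 1 = d"
    using C by (simp add: power2_eq_square algebra_simps)
  moreover have "fps_nth (central_fps 2 * d) 0 = 1"
    by (simp add: central_fps_def even_fps_def d_def)
  ultimately have "central_fps 2 * d = R"
    using radical_unique[of root 1 d "central_fps 2 * d"] by (simp add: R_def d_def numeral_2_eq_2)
  then have "R * central_fps 2 = (central_fps 2)\<^sup>2 * d"
    by (metis mult.commute mult.left_commute power2_eq_square)
  then have "R * central_fps 2 = 1" unfolding C .
  have "?B * (R * (1 - 9 * fps_X ^ 2)) = R * (?B * (1 - fps_const 9 * fps_X\<^sup>2))"
    by (simp add: numeral_fps_const mult_ac)
  also have "\<dots> = (R * central_fps 2) * (1 - fps_const 6 * fps_X\<^sup>2)"
    by (simp only: unweighted_gf mult.assoc)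
  also have "\<dots> = 1 - 6 * fps_X ^ 2"
    unfolding \<open>R * central_fps 2 = 1\<close> by (simp add: numeral_fps_const)
  finally have "?B * (R * (1 - 9 * fps_X ^ 2)) = 1 - 6 * fps_X ^ 2" .
  moreover have "fps_nth (R * (1 - 9 * fps_X ^ 2)) 0 \<noteq> 0"
    using \<open>central_fps 2 * d = R\<close>[symmetric] by (simp add: central_fps_def even_fps_def d_def)
  then have "R * (1 - 9 * fps_X ^ 2) \<noteq> 0" by (metis fps_zero_nth)
  ultimately show ?thesis unfolding R_def d_def by (metis nonzero_mult_div_cancel_right)
qed

lemma unweighted_gf_nth:
  "fps_nth (dyck_nbridge_gf (\<lambda>_. 1) 1 1 :: real fps) n = real (card (nbridges dyck_nsteps n))"
proof -
  have "prod_list (map (\<lambda>_. 1 :: real) w) = 1" for w :: "nstep list"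
    by (induction w) simp_all
  then show ?thesis by (simp add: dyck_nbridge_gf_def)
qed

lemma unweighted_gf_odd: "odd n \<Longrightarrow> fps_nth (dyck_nbridge_gf (\<lambda>_. 1) 1 1 :: real fps) n = 0"
  by (simp add: dyck_nbridge_gf_eq even_fps_def)

lemma unweighted_gf_rec:
  defines "b \<equiv> \<lambda>m. fps_nth (dyck_nbridge_gf (\<lambda>_. 1) 1 1 :: real fps) (2 * m)"
  shows "b 0 = 1" and "b (Suc m) = 9 * b m + central_coeff (Suc m) - 6 * central_coeff m"
proof -
  have B: "dyck_nbridge_gf (\<lambda>_. 1) 1 1 = even_fps b"
    by (simp add: fps_eq_iff even_fps_def b_def unweighted_gf_odd)
  have C: "central_fps 2 = even_fps central_coeff"
    by (simp add: central_fps_def central_coeff_def[abs_def])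
  have rec: "b m - (case m of 0 \<Rightarrow> 0 | Suc k \<Rightarrow> 9 * b k)
      = central_coeff m - (case m of 0 \<Rightarrow> 0 | Suc k \<Rightarrow> 6 * central_coeff k)" for m
    using arg_cong[OF unweighted_gf[where ?'k = real], of "\<lambda>f. fps_nth f (2 * m)"]
    unfolding B C even_fps_mult_quadratic by (simp add: even_fps_def)
  from rec[of 0] show "b 0 = 1" by (simp add: central_coeff_0)
  from rec[of "Suc m"] show "b (Suc m) = 9 * b m + central_coeff (Suc m) - 6 * central_coeff m"
    by simp
qed

lemma unweighted_gf_cutoff:
  "fps_cutoff 10 (dyck_nbridge_gf (\<lambda>_. 1) 1 1 :: real fps)
     = 1 + 7 * fps_X ^ 2 + 63 * fps_X ^ 4 + 583 * fps_X ^ 6 + 5407 * fps_X ^ 8"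
proof (rule fps_ext)
  fix n :: nat
  let ?B = "dyck_nbridge_gf (\<lambda>_. 1) 1 1 :: real fps"
  have c: "central_coeff 1 = 4" "central_coeff 2 = 24" "central_coeff 3 = 160" "central_coeff 4 = 1120"
    using central_coeff_0 central_coeff_Suc[of 0] central_coeff_Suc[of 1] central_coeff_Suc[of 2]
      central_coeff_Suc[of 3]
    by (simp_all add: eval_nat_numeral)
  have b: "fps_nth ?B 0 = 1" "fps_nth ?B 2 = 7" "fps_nth ?B 4 = 63" "fps_nth ?B 6 = 583"
    "fps_nth ?B 8 = 5407"
    using unweighted_gf_rec(1) unweighted_gf_rec(2)[of 0] unweighted_gf_rec(2)[of 1]
      unweighted_gf_rec(2)[of 2] unweighted_gf_rec(2)[of 3] c central_coeff_0
    by (simp_all add: eval_nat_numeral)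
  have "n = 0 \<or> n = 2 \<or> n = 4 \<or> n = 6 \<or> n = 8 \<or> odd n \<or> n \<ge> 10" by presburger
  then show "fps_nth (fps_cutoff 10 ?B) n
      = fps_nth (1 + 7 * fps_X ^ 2 + 63 * fps_X ^ 4 + 583 * fps_X ^ 6 + 5407 * fps_X ^ 8) n"
    using b by (auto simp: numeral_fps_const unweighted_gf_odd)
qed

lemma unweighted_gf_asymptotics:
  fixes B :: "real fps"
  defines "B \<equiv> dyck_nbridge_gf (\<lambda>_. 1) 1 1"
  shows "\<exists>E. E \<in> O(\<lambda>n. 8 powr (real n / 2) / real n powr (3 / 2))
               \<and> (\<forall>n>0. fps_nth B n =
                     (1 + (-1) ^ n) / 2 *
                     (3 ^ n - 2 * sqrt 2 / sqrt pi * (8 powr (real n / 2) / sqrt (real n)) + E n))"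
proof -
  define M where "M = (\<lambda>n. 3 ^ n - 2 * sqrt 2 / sqrt pi * (8 powr (real n / 2) / sqrt (real n)))"
  \<comment> \<open>For odd \<open>n\<close> the prefactor \<open>(1 + (-1) ^ n) / 2\<close>
    vanishes, so \<open>E n\<close> may be set to \<open>0\<close> there.\<close>
  define E where "E = (\<lambda>n. if even n then fps_nth B n - M n else 0)"
  \<comment> \<open>Substituting \<open>m = n / 2\<close> in \<open>m * sqrt m\<close> turns the
    constant \<open>13\<close> into \<open>26 * sqrt 2\<close>.\<close>
  have bound: "\<bar>E n\<bar> \<le> 26 * sqrt 2 / sqrt pi * (8 powr (real n / 2) / real n powr (3 / 2))"
    if "n > 0" for n
  proof (cases "even n")
    case False
    then show ?thesis by (simp add: E_def)
  next
    case True
    then obtain m where n: "n = 2 * m" by auto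
    with that have m: "m > 0" by simp
    have "8 powr (real n / 2) = 8 powr real m" by (simp add: n)
    also have "\<dots> = 8 ^ m" by (rule powr_realpow) simp
    finally have p8: "8 powr (real n / 2) = 8 ^ m" .
    have p32: "real n powr (3 / 2) = real n * sqrt (real n)"
    proof -
      have "real n powr (3 / 2) = real n powr (1 + 1 / 2)" by simp
      also have "\<dots> = real n * sqrt (real n)" unfolding powr_add using that by (simp add: powr_half_sqrt)
      finally show ?thesis .
    qed
    have "M n = 9 ^ m - 2 * 8 ^ m / sqrt (pi * m)"
      unfolding M_def p8 unfolding n by (simp add: power_mult real_sqrt_mult)
    moreover have "13 * 8 ^ m / (sqrt (pi * m) * m) = 26 * sqrt 2 / sqrt pi * (8 ^ m / (real n * sqrt (real n)))"
      unfolding n by (simp add: real_sqrt_mult)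
    ultimately show ?thesis
      using bridge_count_asymptotics[OF unweighted_gf_rec m] True
      unfolding p8 p32 by (simp add: E_def B_def n)
  qed
  have "E \<in> O(\<lambda>n. 8 powr (real n / 2) / real n powr (3 / 2))"
    using bound by (intro bigoI[of _ "26 * sqrt 2 / sqrt pi"] eventually_mono[OF eventually_gt_at_top[of 0]]) simp
  moreover have "fps_nth B n = (1 + (-1) ^ n) / 2 * (M n + E n)" for n
    by (auto simp: E_def B_def unweighted_gf_odd)
  ultimately show ?thesis unfolding M_def by blast
qed

theorem theorem2p4:
  fixes p :: "nstep \<Rightarrow> 'a::field_char_0"
  assumes "p {-1} \<noteq> 0" and "p {1} \<noteq> 0" and "p {-1, 1} \<noteq> 0"
  shows
    "algebraic_of_degree (dyck_nbridge_gf (\<lambda>s. rf_const (p s)) rf_x rf_y) 4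
     \<and> algebraic_of_degree (dyck_nbridge_gf (\<lambda>_. 1) 1 1 :: 'a fps) 2
     \<and> (let B = dyck_nbridge_gf (\<lambda>_. 1) 1 1 :: real fps in
          B = (1 - 6 * fps_X ^ 2)
                / (fps_radical root 2 (1 - 8 * fps_X ^ 2) * (1 - 9 * fps_X ^ 2))
          \<and> fps_cutoff 10 B = 1 + 7 * fps_X ^ 2 + 63 * fps_X ^ 4 + 583 * fps_X ^ 6 + 5407 * fps_X ^ 8
          \<and> (\<forall>n. fps_nth B n = real (card (nbridges dyck_nsteps n)))
          \<and> (\<exists>E. E \<in> O(\<lambda>n. 8 powr (real n / 2) / real n powr (3 / 2))
               \<and> (\<forall>n>0. fps_nth B n =
                     (1 + (-1) ^ n) / 2 *
                     (3 ^ n - 2 * sqrt 2 / sqrt pi * (8 powr (real n / 2) / sqrt (real n)) + E n))))"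
  unfolding Let_def
  by (intro conjI allI dyck_nbridge_gf_ratfun_degree_4[OF assms] unweighted_gf_degree_2
      unweighted_gf_closed_form unweighted_gf_cutoff unweighted_gf_nth unweighted_gf_asymptotics)

end
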